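(* Let $K$ be a field, $P=K[x_1,\dots,x_n]$, let $\mathcal{O}=\{t_1,\dots,t_\mu\}$ be a (nonempty) order ideal of monomials in $P$ and $\sigma$ a term ordering on $\mathbb{T}^n$. Let $R=K[S_{c\mathcal{O},\sigma}]$ and let $\{g_1^*,\dots,g_\eta^*\}\subset R[x_1,\dots,x_n]$ be the generic $(\mathcal{O},\sigma)$-Gröbner prebasis. For each pair $1\le j<k\le\eta$, reduce the S-polynomial $\frac{\mathrm{lcm}(b_j,b_k)}{b_j}g_j^*-\frac{\mathrm{lcm}(b_j,b_k)}{b_k}g_k^*$ by $g_1^*,\dots,g_\eta^*$, making arbitrary choices of reduction steps, until a polynomial of the form $\sum_{i=1}^\mu r_i^{(j,k)}t_i$ with $r_i^{(j,k)}\in R$ is obtained, and let $J\subseteq R$ be the ideal generated by all the coefficients $r_i^{(j,k)}$ (all pairs $j<k$ and all $i$). Then all the ideals $J$ obtained in this way, for all possible choices of the reductions, are equal, and they coincide with the defining ideal $I(\mathbb{G}_{\mathcal{O},\sigma})$ of the $(\mathcal{O},\sigma)$-Gröbner basis scheme.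
   Context: Notation: $\mathbf{x}=x_1,\dots,x_n$, $\mathbb{T}^n=\{x_1^{\alpha_1}\cdots x_n^{\alpha_n}\mid\alpha_i\ge0\}$. An order ideal is a finite set $\mathcal{O}=\{t_1,\dots,t_\mu\}\subset\mathbb{T}^n$ (here nonempty) closed under taking divisors. Its border is $\partial\mathcal{O}=(x_1\mathcal{O}\cup\dots\cup x_n\mathcal{O})\setminus\mathcal{O}=\{b_1,\dots,b_\nu\}$. The corners $c\mathcal{O}\subseteq\partial\mathcal{O}$ are the minimal generators of the monoid ideal $\mathbb{T}^n\setminus\mathcal{O}$; the labelling is chosen so that $c\mathcal{O}=\{b_1,\dots,b_\eta\}$, $\eta\le\nu$. Let $\mathbf{c}=\{c_{ij}\mid 1\le i\le\mu,1\le j\le\nu\}$ be new indeterminates. For $k=1,\dots,n$ the generic multiplication matrix $\mathcal{A}_k\in\mathrm{Mat}_\mu(K[\mathbf{c}])$ has $(i,j)$ entry $\delta_{im}$ if $x_kt_j=t_m\in\mathcal{O}$, and $c_{im}$ if $x_kt_j=b_m\in\partial\mathcal{O}$. $I(\mathbb{B}_{\mathcal{O}})\subseteq K[\mathbf{c}]$ is the ideal generated by all entries of all $\mathcal{A}_k\mathcal{A}_\ell-\mathcal{A}_\ell\mathcal{A}_k$, $1\le k<\ell\le n$. $S_{\mathcal{O},\sigma}=\{c_{ij}\mid b_j>_\sigma t_i\}$; $L_{\mathcal{O},\sigma}$ is the ideal of $K[\mathbf{c}]$ generated by the $c_{ij}\notin S_{\mathcal{O},\sigma}$; $S_{c\mathcal{O},\sigma}=\{c_{ij}\in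 S_{\mathcal{O},\sigma}\mid j\le\eta\}$. For $j=1,\dots,\eta$ let $g_j^*=b_j-\sum_{\{i\mid b_j>_\sigma t_i\}}c_{ij}t_i$ (generic $(\mathcal{O},\sigma)$-Gröbner prebasis). $I(\mathbb{G}_{\mathcal{O},\sigma})=(L_{\mathcal{O},\sigma}+I(\mathbb{B}_{\mathcal{O}}))\cap K[S_{c\mathcal{O},\sigma}]$. Reduction: a polynomial $f\in R[\mathbf{x}]$ is viewed as an $R$-linear combination of terms in $\mathbb{T}^n$. A reduction step chooses a term $u\in\mathbb{T}^n$ whose coefficient $r\in R$ in $f$ is nonzero and an index $j\le\eta$ with $b_j\mid u$, and replaces $f$ by $f-r\,\frac{u}{b_j}\,g_j^*$. A finite sequence of such steps is performed until every term of the result lies in $\mathcal{O}$. *)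

theory Defs
  imports "HOL-Library.Poly_Mapping" "HOL-Algebra.Ideal" "HOL-Algebra.AbelCoset"
    "Jordan_Normal_Form.Matrix"
begin

text \<open>A term is identified with its exponent vector, so multiplication of terms is addition,
  the term \<open>1\<close> is \<open>0\<close>, and an exact quotient of terms is a difference.
  All indices start at \<open>0\<close>; the indeterminate with index \<open>k < n\<close> is
  \<open>Poly_Mapping.single k 1\<close>.\<close>

type_synonym pterm = "nat \<Rightarrow>\<^sub>0 nat"

definition terms :: "nat \<Rightarrow> pterm set" where
  "terms n = {t. Poly_Mapping.keys t \<subseteq> {..<n}}"

definition term_dvd :: "pterm \<Rightarrow> pterm \<Rightarrow> bool" where
  "term_dvd s t \<longleftrightarrow> (\<exists>u. t = s + u)"

text \<open>Subtraction of exponents is truncated, so \<open>s + (t - s)\<close> is the pointwise maximum.\<close>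

definition term_lcm :: "pterm \<Rightarrow> pterm \<Rightarrow> pterm" where
  "term_lcm s t = s + (t - s)"

definition order_ideal :: "nat \<Rightarrow> pterm set \<Rightarrow> bool" where
  "order_ideal n O' \<longleftrightarrow>
     finite O' \<and> O' \<subseteq> terms n \<and> (\<forall>t\<in>O'. \<forall>s. term_dvd s t \<longrightarrow> s \<in> O')"

definition border :: "nat \<Rightarrow> pterm set \<Rightarrow> pterm set" where
  "border n O' = (\<Union>k<n. (\<lambda>t. Poly_Mapping.single k 1 + t) ` O') - O'"

definition corners :: "nat \<Rightarrow> pterm set \<Rightarrow> pterm set" where
  "corners n O' =
     {b \<in> terms n - O'. \<forall>s \<in> terms n - O'. term_dvd s b \<longrightarrow> s = b}"

text \<open>\<open>(s, t) \<in> \<sigma>\<close> means \<open>s \<le>\<^sub>\<sigma> t\<close>.\<close>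

definition term_ordering :: "nat \<Rightarrow> pterm rel \<Rightarrow> bool" where
  "term_ordering n \<sigma> \<longleftrightarrow>
     linear_order_on (terms n) \<sigma> \<and>
     (\<forall>t \<in> terms n. (0, t) \<in> \<sigma>) \<and>
     (\<forall>s \<in> terms n. \<forall>t \<in> terms n. \<forall>u \<in> terms n. (s, t) \<in> \<sigma> \<longrightarrow> (s + u, t + u) \<in> \<sigma>)"

definition term_less :: "pterm rel \<Rightarrow> pterm \<Rightarrow> pterm \<Rightarrow> bool" where
  "term_less \<sigma> s t \<longleftrightarrow> (s, t) \<in> \<sigma> \<and> s \<noteq> t"

text \<open>The indeterminate \<open>c\<^sub>i\<^sub>j\<close> is indexed by the pair \<open>(i, j)\<close>. The type
  below has indeterminates for all pairs of natural numbers; the polynomial ring in a given set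
  \<open>V\<close> of indeterminates is the structure \<open>poly_ring V\<close>, and ideals
  are always formed in such a structure.\<close>

type_synonym 'k cpoly = "((nat \<times> nat) \<Rightarrow>\<^sub>0 nat) \<Rightarrow>\<^sub>0 'k"

definition poly_ring :: "(nat \<times> nat) set \<Rightarrow> 'k::field cpoly ring" where
  "poly_ring V =
     \<lparr>carrier = {p. \<forall>m \<in> Poly_Mapping.keys p. Poly_Mapping.keys m \<subseteq> V},
      monoid.mult = (*), one = 1, zero = 0, add = (+)\<rparr>"

definition cvar :: "nat \<times> nat \<Rightarrow> 'k::field cpoly" where
  "cvar ij = Poly_Mapping.single (Poly_Mapping.single ij 1) 1"

definition all_c :: "nat \<Rightarrow> nat \<Rightarrow> (nat \<times> nat) set" where
  "all_c \<mu> \<nu> = {..<\<mu>} \<times> {..<\<nu>}"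

text \<open>With \<open>m = \<nu>\<close> this is \<open>S\<^sub>O\<^sub>,\<^sub>\<sigma>\<close>; with \<open>m = \<eta>\<close>, the number of corners, it
  is \<open>S\<^sub>c\<^sub>O\<^sub>,\<^sub>\<sigma>\<close>.\<close>

definition S_set ::
  "pterm rel \<Rightarrow> nat \<Rightarrow> (nat \<Rightarrow> pterm) \<Rightarrow> (nat \<Rightarrow> pterm) \<Rightarrow> nat \<Rightarrow> (nat \<times> nat) set" where
  "S_set \<sigma> \<mu> t b m = {(i, j). i < \<mu> \<and> j < m \<and> term_less \<sigma> (t i) (b j)}"

definition gen_mult_matrix ::
  "nat \<Rightarrow> nat \<Rightarrow> (nat \<Rightarrow> pterm) \<Rightarrow> (nat \<Rightarrow> pterm) \<Rightarrow> nat \<Rightarrow> 'k::field cpoly mat" where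
  "gen_mult_matrix \<mu> \<nu> t b k = mat \<mu> \<mu> (\<lambda>(i, j).
     let u = Poly_Mapping.single k 1 + t j in
       if u \<in> t ` {..<\<mu>}
       then (if i = the_inv_into {..<\<mu>} t u then 1 else 0)
       else cvar (i, the_inv_into {..<\<nu>} b u))"

definition border_scheme_ideal ::
  "nat \<Rightarrow> nat \<Rightarrow> nat \<Rightarrow> (nat \<Rightarrow> pterm) \<Rightarrow> (nat \<Rightarrow> pterm) \<Rightarrow> 'k::field cpoly set" where
  "border_scheme_ideal n \<mu> \<nu> t b =
     Idl\<^bsub>poly_ring (all_c \<mu> \<nu>)\<^esub>
       {(gen_mult_matrix \<mu> \<nu> t b k * gen_mult_matrix \<mu> \<nu> t b l
          - gen_mult_matrix \<mu> \<nu> t b l * gen_mult_matrix \<mu> \<nu> t b k) $$ (i, j)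
        | k l i j. k < l \<and> l < n \<and> i < \<mu> \<and> j < \<mu>}"

definition L_ideal ::
  "pterm rel \<Rightarrow> nat \<Rightarrow> nat \<Rightarrow> (nat \<Rightarrow> pterm) \<Rightarrow> (nat \<Rightarrow> pterm) \<Rightarrow> 'k::field cpoly set" where
  "L_ideal \<sigma> \<mu> \<nu> t b =
     Idl\<^bsub>poly_ring (all_c \<mu> \<nu>)\<^esub> (cvar ` (all_c \<mu> \<nu> - S_set \<sigma> \<mu> t b \<nu>))"

definition groebner_scheme_ideal ::
  "nat \<Rightarrow> pterm rel \<Rightarrow> nat \<Rightarrow> nat \<Rightarrow> nat \<Rightarrow> (nat \<Rightarrow> pterm) \<Rightarrow> (nat \<Rightarrow> pterm)
    \<Rightarrow> 'k::field cpoly set" where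
  "groebner_scheme_ideal n \<sigma> \<mu> \<nu> \<eta> t b =
     (L_ideal \<sigma> \<mu> \<nu> t b <+>\<^bsub>poly_ring (all_c \<mu> \<nu>)\<^esub> border_scheme_ideal n \<mu> \<nu> t b)
       \<inter> carrier (poly_ring (S_set \<sigma> \<mu> t b \<eta>))"

type_synonym 'k xpoly = "pterm \<Rightarrow>\<^sub>0 'k cpoly"

definition prebasis ::
  "pterm rel \<Rightarrow> nat \<Rightarrow> (nat \<Rightarrow> pterm) \<Rightarrow> (nat \<Rightarrow> pterm) \<Rightarrow> nat \<Rightarrow> 'k::field xpoly" where
  "prebasis \<sigma> \<mu> t b j =
     Poly_Mapping.single (b j) 1
       - (\<Sum>i | i < \<mu> \<and> term_less \<sigma> (t i) (b j). Poly_Mapping.single (t i) (cvar (i, j)))"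

definition S_poly ::
  "pterm rel \<Rightarrow> nat \<Rightarrow> (nat \<Rightarrow> pterm) \<Rightarrow> (nat \<Rightarrow> pterm) \<Rightarrow> nat \<Rightarrow> nat \<Rightarrow> 'k::field xpoly" where
  "S_poly \<sigma> \<mu> t b j k =
     Poly_Mapping.single (term_lcm (b j) (b k) - b j) 1 * prebasis \<sigma> \<mu> t b j
       - Poly_Mapping.single (term_lcm (b j) (b k) - b k) 1 * prebasis \<sigma> \<mu> t b k"

definition red_step ::
  "pterm rel \<Rightarrow> nat \<Rightarrow> nat \<Rightarrow> (nat \<Rightarrow> pterm) \<Rightarrow> (nat \<Rightarrow> pterm)
    \<Rightarrow> 'k::field xpoly \<Rightarrow> 'k xpoly \<Rightarrow> bool" where
  "red_step \<sigma> \<mu> \<eta> t b f f' \<longleftrightarrow>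
     (\<exists>u j. Poly_Mapping.lookup f u \<noteq> 0 \<and> j < \<eta> \<and> term_dvd (b j) u \<and>
        f' = f - Poly_Mapping.single (u - b j) (Poly_Mapping.lookup f u) * prebasis \<sigma> \<mu> t b j)"

definition reduces_completely ::
  "pterm rel \<Rightarrow> nat \<Rightarrow> nat \<Rightarrow> (nat \<Rightarrow> pterm) \<Rightarrow> (nat \<Rightarrow> pterm)
    \<Rightarrow> 'k::field xpoly \<Rightarrow> 'k xpoly \<Rightarrow> bool" where
  "reduces_completely \<sigma> \<mu> \<eta> t b f h \<longleftrightarrow>
     (red_step \<sigma> \<mu> \<eta> t b)\<^sup>*\<^sup>* f h \<and> Poly_Mapping.keys h \<subseteq> t ` {..<\<mu>}"

definition reduction_ideal ::
  "pterm rel \<Rightarrow> nat \<Rightarrow> nat \<Rightarrow> (nat \<Rightarrow> pterm) \<Rightarrow> (nat \<Rightarrow> pterm)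
    \<Rightarrow> (nat \<Rightarrow> nat \<Rightarrow> 'k::field xpoly) \<Rightarrow> 'k cpoly set" where
  "reduction_ideal \<sigma> \<mu> \<eta> t b h =
     Idl\<^bsub>poly_ring (S_set \<sigma> \<mu> t b \<eta>)\<^esub>
       {Poly_Mapping.lookup (h j k) (t i) | j k i. j < k \<and> k < \<eta> \<and> i < \<mu>}"

definition reduction_ideals ::
  "pterm rel \<Rightarrow> nat \<Rightarrow> nat \<Rightarrow> (nat \<Rightarrow> pterm) \<Rightarrow> (nat \<Rightarrow> pterm) \<Rightarrow> 'k::field cpoly set set" where
  "reduction_ideals \<sigma> \<mu> \<eta> t b =
     {reduction_ideal \<sigma> \<mu> \<eta> t b h | h.
        \<forall>j k. j < k \<and> k < \<eta> \<longrightarrow> reduces_completely \<sigma> \<mu> \<eta> t b (S_poly \<sigma> \<mu> t b j k) (h j k)}"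

end

theory Submission
  imports Defs
begin

text \<open>
  Write \<open>J\<close> for the ideal generated by the coefficients of the reduced S-polynomials, \<open>Q\<close> for
  the ideal generated by the indeterminates outside \<open>S\<^sub>O\<^sub>,\<^sub>\<sigma>\<close> and the entries of the commutators
  of the generic multiplication matrices \<open>A\<^sub>k\<close>. Retracting \<open>K[c]\<close> onto a subring
  \<open>K[V]\<close> shows that ideals may be formed in the full polynomial ring and intersected with
  \<open>K[V]\<close> afterwards (\<open>genideal_poly_ring\<close>), so the claim becomes \<open>J \<inter> R = Q \<inter> R\<close> for
  \<open>R = K[S\<^sub>c\<^sub>O\<^sub>,\<^sub>\<sigma>]\<close>. The ideal on the right does not depend on the reductions, and complete
  reductions exist because a term ordering is well-founded (\<open>reduces_completely_exists\<close>).

  Both inclusions use an assignment \<open>F\<close> of vectors of length \<open>\<mu>\<close> to terms whose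
  linear extension kills all multiples \<open>u g\<^sub>j\<close> of the prebasis modulo the relevant ideal
  (\<open>respects_prebasis\<close>). Such a linear extension is constant modulo the ideal along reductions
  (\<open>reduction_icong\<close>).

  For \<open>J \<subseteq> Q\<close>, the matrices \<open>A\<^sub>k\<close> commute modulo \<open>Q\<close> and therefore make \<open>(K[c]/Q)\<^sup>\<mu>\<close> a module
  over the polynomial ring in \<open>x\<^sub>1, \<dots>, x\<^sub>n\<close>, in which \<open>F(u) = u(A\<^sub>1, \<dots>, A\<^sub>n) e\<close> with \<open>e\<close> the unit
  vector at the term \<open>1\<close>. Here \<open>t\<^sub>i\<close> goes to the \<open>i\<close>-th unit vector and the border term \<open>b\<^sub>j\<close> to
  the column \<open>(c\<^sub>i\<^sub>j)\<^sub>i\<close>, so each \<open>g\<^sub>j\<close> goes to \<open>0\<close>. An S-polynomial then goes to \<open>0\<close> as well,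
  whereas its reduced form goes to the vector of its coefficients; these lie in \<open>Q\<close>
  (\<open>reduction_gens_in_scheme_ideal\<close>).

  For \<open>Q \<inter> R \<subseteq> J\<close>, let \<open>N(u)\<close> be the coefficient vector of the normal form of \<open>u\<close> that arises by
  always rewriting with one chosen corner dividing the term. Since the S-polynomials reduce to
  \<open>0\<close> modulo \<open>J\<close>, Buchberger's argument shows that \<open>N\<close> kills the multiples of all \<open>g\<^sub>j\<close>
  modulo \<open>J\<close>, whichever corner was chosen (\<open>respects_prebasis_nf\<close>), and hence that multiplication by
  indeterminates acts on normal forms modulo \<open>J\<close> (\<open>nf_multiplicative\<close>). The substitution
  \<open>c\<^sub>i\<^sub>j \<mapsto> N(b\<^sub>j)\<^sub>i\<close> turns \<open>A\<^sub>k\<close> into the matrix of multiplication by \<open>x\<^sub>k\<close>, so it maps \<open>Q\<close> into \<open>J\<close>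
  (\<open>nf_subst_scheme_gens\<close>). As it fixes \<open>R\<close> pointwise, it proves the inclusion.
\<close>



abbreviation (input) lookup :: "('a \<Rightarrow>\<^sub>0 'b::zero) \<Rightarrow> 'a \<Rightarrow> 'b" where
  "lookup \<equiv> Poly_Mapping.lookup"

abbreviation (input) keys :: "('a \<Rightarrow>\<^sub>0 'b::zero) \<Rightarrow> 'a set" where
  "keys \<equiv> Poly_Mapping.keys"

abbreviation (input) single :: "'a \<Rightarrow> 'b \<Rightarrow> ('a \<Rightarrow>\<^sub>0 'b::zero)" where
  "single \<equiv> Poly_Mapping.single"

section \<open>Extending functions of terms to polynomials\<close>

text \<open>A coefficient can act by plain multiplication, which gives the linear functionals on polynomials
  in \<open>x\<^sub>1, \<dots>, x\<^sub>n\<close>, or through the embedding of the constants, which gives the substitution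
  homomorphisms. Letting \<open>g\<close> absorb the coefficient covers both.\<close>

definition additive_ext :: "('m \<Rightarrow> 'a \<Rightarrow> 'c) \<Rightarrow> ('m \<Rightarrow>\<^sub>0 'a::ab_group_add) \<Rightarrow> 'c::ab_group_add" where
  "additive_ext g p = (\<Sum>m\<in>keys p. g m (lookup p m))"

lemma additive_ext_superset:
  assumes "\<And>m. g m 0 = 0" "finite A" "keys p \<subseteq> A"
  shows "additive_ext g p = (\<Sum>m\<in>A. g m (lookup p m))"
  unfolding additive_ext_def
  by (rule sum.mono_neutral_left) (use assms in \<open>auto simp: in_keys_iff\<close>)

lemma additive_ext_additive:
  fixes g :: "'m \<Rightarrow> 'a::ab_group_add \<Rightarrow> 'c::ab_group_add"
  assumes "\<And>m. additive (g m)"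
  shows "additive (additive_ext g)"
proof
  fix p q :: "'m \<Rightarrow>\<^sub>0 'a"
  note z = additive.zero[OF assms]
  let ?A = "keys p \<union> keys q"
  have "additive_ext g (p + q) = (\<Sum>m\<in>?A. g m (lookup (p + q) m))"
    by (rule additive_ext_superset) (use z Poly_Mapping.keys_add[of p q] in auto)
  also have "\<dots> = (\<Sum>m\<in>?A. g m (lookup p m)) + (\<Sum>m\<in>?A. g m (lookup q m))"
    by (simp add: lookup_add additive.add[OF assms] sum.distrib)
  also have "\<dots> = additive_ext g p + additive_ext g q"
    by (simp add: additive_ext_superset[of g ?A] z)
  finally show "additive_ext g (p + q) = additive_ext g p + additive_ext g q" .
qed

lemma additive_ext_single:
  assumes "g m 0 = 0"
  shows "additive_ext g (single m c) = g m c"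
  using assms by (auto simp: additive_ext_def)

lemma poly_mapping_sum_single:
  fixes p :: "'m \<Rightarrow>\<^sub>0 'a::comm_monoid_add"
  shows "p = (\<Sum>m\<in>keys p. single m (lookup p m))"
proof (rule poly_mapping_eqI)
  fix k
  have "(\<Sum>m\<in>keys p. lookup (single m (lookup p m)) k)
      = (\<Sum>m\<in>keys p. if m = k then lookup p m else 0)"
    by (rule sum.cong) (auto simp: lookup_single when_def)
  also have "\<dots> = lookup p k"
    by (simp add: sum.delta in_keys_iff)
  finally show "lookup p k = lookup (\<Sum>m\<in>keys p. single m (lookup p m)) k"
    by (simp add: lookup_sum)
qed

lemma poly_mapping_additive_induct:
  fixes p :: "'m \<Rightarrow>\<^sub>0 'a::comm_monoid_add"
  assumes "\<And>m c. P (single m c)" "\<And>p q. P p \<Longrightarrow> P q \<Longrightarrow> P (p + q)"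
  shows "P p"
proof -
  have "P (\<Sum>m\<in>A. single m (lookup p m))" if "finite A" for A
    using that
  proof induction
    case empty
    show ?case using assms(1)[of undefined 0] by simp
  next
    case (insert m A)
    then show ?case using assms by simp
  qed
  from this[OF finite_keys[of p]] show ?thesis
    using poly_mapping_sum_single[of p] by simp
qed

definition linear_ext :: "('m \<Rightarrow> 'c) \<Rightarrow> ('m \<Rightarrow>\<^sub>0 'c) \<Rightarrow> 'c::comm_ring_1" where
  "linear_ext F = additive_ext (\<lambda>m c. c * F m)"

lemma additive_linear_ext: "additive (linear_ext F)"
  unfolding linear_ext_def by (rule additive_ext_additive) (simp add: additive_def algebra_simps)

lemma linear_ext_single [simp]: "linear_ext F (single m c) = c * F m"
  by (simp add: linear_ext_def additive_ext_single)

lemmas linear_ext_diff [simp] = additive.diff[OF additive_linear_ext]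
  and linear_ext_sum [simp] = additive.sum[OF additive_linear_ext]

lemma linear_ext_superset:
  assumes "finite A" "keys p \<subseteq> A"
  shows "linear_ext F p = (\<Sum>m\<in>A. lookup p m * F m)"
  unfolding linear_ext_def using assms by (subst additive_ext_superset[of _ A]) auto


section \<open>Substitution\<close>

definition monom_subst :: "('x \<Rightarrow> 'c::comm_ring_1) \<Rightarrow> ('x \<Rightarrow>\<^sub>0 nat) \<Rightarrow> 'c" where
  "monom_subst v m = (\<Prod>x\<in>keys m. v x ^ lookup m x)"

text \<open>Substitutions serve as retractions onto \<open>K[V]\<close> and for inserting normal forms for the
  \<open>c\<^sub>i\<^sub>j\<close>.\<close>

definition subst :: "(nat \<times> nat \<Rightarrow> 'k::field cpoly) \<Rightarrow> 'k cpoly \<Rightarrow> 'k cpoly" where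
  "subst v = additive_ext (\<lambda>m c. single 0 c * monom_subst v m)"

lemma monom_subst_superset:
  assumes "finite A" "keys m \<subseteq> A"
  shows "monom_subst v m = (\<Prod>x\<in>A. v x ^ lookup m x)"
  unfolding monom_subst_def
  by (rule prod.mono_neutral_left) (use assms in \<open>auto simp: in_keys_iff\<close>)

lemma monom_subst_zero [simp]: "monom_subst v 0 = 1"
  by (simp add: monom_subst_def)

lemma monom_subst_add: "monom_subst v (l + m) = monom_subst v l * monom_subst v m"
proof -
  let ?A = "keys l \<union> keys m"
  have "monom_subst v (l + m) = (\<Prod>x\<in>?A. v x ^ lookup (l + m) x)"
    by (rule monom_subst_superset) (use Poly_Mapping.keys_add[of l m] in auto)
  then show ?thesis
    by (simp add: lookup_add power_add prod.distrib monom_subst_superset[of ?A])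
qed

lemma monom_subst_single [simp]: "monom_subst v (single x 1) = v x"
  by (simp add: monom_subst_def del: One_nat_def)

lemma additive_subst: "additive (subst v)"
  unfolding subst_def
  by (rule additive_ext_additive) (simp add: additive_def single_add algebra_simps)

lemma subst_single: "subst v (single m c) = single 0 c * monom_subst v m"
  by (simp add: subst_def additive_ext_single)

lemmas subst_zero [simp] = additive.zero[OF additive_subst]
  and subst_add [simp] = additive.add[OF additive_subst]
  and subst_diff [simp] = additive.diff[OF additive_subst]
  and subst_sum [simp] = additive.sum[OF additive_subst]

lemma subst_mult [simp]: "subst v (p * q) = subst v p * subst v q"
proof (induction p rule: poly_mapping_additive_induct)
  case (1 l c)
  show ?case
  proof (induction q rule: poly_mapping_additive_induct)
    case (1 m d)
    have "single 0 (c * d) = (single 0 c * single 0 d :: 'a cpoly)"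
      by (simp add: mult_single)
    then show ?case
      by (simp only: mult_single[of l] subst_single monom_subst_add ac_simps)
  qed (simp add: algebra_simps)
qed (simp add: algebra_simps)

lemma subst_one [simp]: "subst v 1 = 1"
  by (subst single_one[symmetric]) (simp only: subst_single monom_subst_zero, simp)

lemma subst_cvar [simp]: "subst v (cvar x) = v x"
  by (simp add: cvar_def subst_single del: One_nat_def)

lemma monom_subst_cvar: "monom_subst cvar m = (single m 1 :: 'k::field cpoly)"
proof -
  have pw: "cvar x ^ k = (single (single x k) 1 :: 'k cpoly)" for x k
    by (induction k) (simp_all add: cvar_def mult_single single_add[symmetric])
  have "(\<Prod>x\<in>A. cvar x ^ lookup m x)
      = (single (\<Sum>x\<in>A. single x (lookup m x)) 1 :: 'k cpoly)" if "finite A" for A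
    using that by induction (simp_all add: pw mult_single)
  from this[OF finite_keys[of m]] show ?thesis
    using poly_mapping_sum_single[of m] by (simp add: monom_subst_def)
qed


section \<open>Polynomial rings in subsets of the indeterminates\<close>

abbreviation (input) pcarrier :: "(nat \<times> nat) set \<Rightarrow> 'k::field cpoly set" where
  "pcarrier V \<equiv> carrier (poly_ring V)"

lemma pcarrier_iff: "p \<in> pcarrier V \<longleftrightarrow> (\<forall>m\<in>keys p. keys m \<subseteq> V)"
  by (simp add: poly_ring_def)

lemma pcarrier_zero [simp]: "0 \<in> pcarrier V"
  by (simp add: pcarrier_iff)

lemma pcarrier_one [simp]: "1 \<in> pcarrier V"
  by (simp add: pcarrier_iff)

lemma pcarrier_const [simp]: "single 0 c \<in> pcarrier V"
  by (simp add: pcarrier_iff)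

lemma pcarrier_cvar: "x \<in> V \<Longrightarrow> cvar x \<in> pcarrier V"
  by (simp add: pcarrier_iff cvar_def)

lemma pcarrier_add: "p \<in> pcarrier V \<Longrightarrow> q \<in> pcarrier V \<Longrightarrow> p + q \<in> pcarrier V"
  using Poly_Mapping.keys_add[of p q] by (fastforce simp: pcarrier_iff)

lemma pcarrier_mult:
  assumes "p \<in> pcarrier V" "q \<in> pcarrier V"
  shows "p * q \<in> pcarrier V"
  unfolding pcarrier_iff
proof
  fix m assume "m \<in> keys (p * q)"
  then obtain k l where kl: "m = k + l" "k \<in> keys p" "l \<in> keys q"
    using Poly_Mapping.keys_mult[of p q] by auto
  then show "keys m \<subseteq> V"
    using assms Poly_Mapping.keys_add[of k l] by (fastforce simp: pcarrier_iff)
qed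

lemma pcarrier_uminus: "p \<in> pcarrier V \<Longrightarrow> - p \<in> pcarrier V"
  by (simp add: pcarrier_iff)

lemma pcarrier_diff: "p \<in> pcarrier V \<Longrightarrow> q \<in> pcarrier V \<Longrightarrow> p - q \<in> pcarrier V"
  using pcarrier_add[of p V "- q"] pcarrier_uminus[of q V] by simp

lemma pcarrier_sum: "(\<And>x. x \<in> A \<Longrightarrow> f x \<in> pcarrier V) \<Longrightarrow> sum f A \<in> pcarrier V"
  by (induction A rule: infinite_finite_induct) (auto intro: pcarrier_add)

lemma pcarrier_mono: "V \<subseteq> W \<Longrightarrow> pcarrier V \<subseteq> pcarrier W"
  unfolding subset_iff pcarrier_iff by blast

lemma subst_in_pcarrier:
  assumes "\<And>x. v x \<in> pcarrier V"
  shows "subst v p \<in> pcarrier V"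
proof -
  have pow: "v x ^ k \<in> pcarrier V" for x k
    by (induction k) (auto intro: pcarrier_mult assms)
  have "(\<Prod>x\<in>A. v x ^ lookup m x) \<in> pcarrier V" for A m
    by (induction A rule: infinite_finite_induct) (auto intro: pcarrier_mult pow)
  then show ?thesis
    by (induction p rule: poly_mapping_additive_induct)
      (auto simp: subst_single monom_subst_def intro: pcarrier_mult pcarrier_add)
qed

lemma subst_eq_self:
  assumes "p \<in> pcarrier V" "\<And>x. x \<in> V \<Longrightarrow> v x = cvar x"
  shows "subst v p = p"
proof -
  have m: "monom_subst v m = single m 1" if "m \<in> keys p" for m
    unfolding monom_subst_cvar[symmetric] monom_subst_def
    by (rule prod.cong) (use that assms in \<open>unfold pcarrier_iff, auto simp: subset_iff\<close>)
  have "subst v p = (\<Sum>m\<in>keys p. single m (lookup p m))"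
    unfolding subst_def additive_ext_def
    by (rule sum.cong) (simp_all add: m mult_single)
  then show ?thesis
    using poly_mapping_sum_single[of p] by simp
qed

lemma ring_poly_ring: "ring (poly_ring V :: 'k::field cpoly ring)"
proof (rule ringI)
  show "abelian_group (poly_ring V :: 'k cpoly ring)"
  proof (rule abelian_groupI)
    fix p :: "'k cpoly" assume "p \<in> pcarrier V"
    then show "\<exists>q\<in>pcarrier V. q \<oplus>\<^bsub>poly_ring V\<^esub> p = \<zero>\<^bsub>poly_ring V\<^esub>"
      by (intro bexI[of _ "- p"]) (auto simp: poly_ring_def)
  next
    fix p q :: "'k cpoly" assume "p \<in> pcarrier V" "q \<in> pcarrier V"
    then show "p \<oplus>\<^bsub>poly_ring V\<^esub> q \<in> pcarrier V"
      using pcarrier_add[of p V q] by (simp add: poly_ring_def)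
  qed (simp_all add: poly_ring_def algebra_simps)
  show "Group.monoid (poly_ring V :: 'k cpoly ring)"
  proof (rule monoidI)
    fix p q :: "'k cpoly" assume "p \<in> pcarrier V" "q \<in> pcarrier V"
    then show "p \<otimes>\<^bsub>poly_ring V\<^esub> q \<in> pcarrier V"
      using pcarrier_mult[of p V q] by (simp add: poly_ring_def)
  qed (simp_all add: poly_ring_def algebra_simps)
qed (simp_all add: poly_ring_def algebra_simps)

interpretation ring_module: Modules.module "(*) :: 'a::comm_ring_1 \<Rightarrow> 'a \<Rightarrow> 'a"
  by unfold_locales (simp_all add: algebra_simps)

abbreviation ideal_of :: "'a::comm_ring_1 set \<Rightarrow> 'a set" where
  "ideal_of \<equiv> ring_module.span"

lemma ideal_of_scale_right: "x \<in> ideal_of G \<Longrightarrow> x * c \<in> ideal_of G"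
  using ring_module.span_scale[of x G c] by (simp add: mult.commute)

lemma subst_ideal_of:
  assumes "\<And>g. g \<in> G \<Longrightarrow> subst v g \<in> ideal_of H" "p \<in> ideal_of G"
  shows "subst v p \<in> ideal_of H"
  using assms(2)
proof (induction rule: ring_module.span_induct_alt)
  case base
  show ?case by (simp add: ring_module.span_zero)
next
  case (step c g y)
  then show ?case
    using assms(1) by (simp add: ring_module.span_add ring_module.span_scale)
qed

text \<open>The retraction of \<open>K[c]\<close> onto \<open>K[V]\<close> maps a combination of elements of \<open>G\<close> with
  arbitrary coefficients to one with coefficients in \<open>K[V]\<close> and fixes \<open>K[V]\<close>. This allows all later
  membership proofs to ignore in which indeterminates the coefficients live.\<close>

lemma genideal_poly_ring:
  fixes G :: "'k::field cpoly set"
  assumes "G \<subseteq> pcarrier V"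
  shows "Idl\<^bsub>poly_ring V\<^esub> G = ideal_of G \<inter> pcarrier V"
proof
  interpret R: ring "poly_ring V :: 'k cpoly ring" by (rule ring_poly_ring)
  interpret J: ideal "Idl\<^bsub>poly_ring V\<^esub> G" "poly_ring V"
    by (rule R.genideal_ideal[OF assms])
  have "ideal (ideal_of G \<inter> pcarrier V) (poly_ring V)"
  proof (rule idealI[OF ring_poly_ring])
    show "subgroup (ideal_of G \<inter> pcarrier V) (add_monoid (poly_ring V))"
    proof (rule R.add.subgroupI)
      show "ideal_of G \<inter> pcarrier V \<noteq> {}"
        using ring_module.span_zero[of G] pcarrier_zero by blast
      fix p assume p: "p \<in> ideal_of G \<inter> pcarrier V"
      have "\<ominus>\<^bsub>poly_ring V\<^esub> p = - p"
        using R.minus_equality[of "- p" p] p pcarrier_uminus[of p V] by (simp add: poly_ring_def)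
      then show "\<ominus>\<^bsub>poly_ring V\<^esub> p \<in> ideal_of G \<inter> pcarrier V"
        using p by (auto simp: ring_module.span_neg intro: pcarrier_uminus)
      fix q assume q: "q \<in> ideal_of G \<inter> pcarrier V"
      show "p \<oplus>\<^bsub>poly_ring V\<^esub> q \<in> ideal_of G \<inter> pcarrier V"
        using p q pcarrier_add[of p V q] by (simp add: poly_ring_def ring_module.span_add)
    qed auto
  next
    fix a x :: "'k cpoly" assume ax: "a \<in> ideal_of G \<inter> pcarrier V" "x \<in> pcarrier V"
    show "x \<otimes>\<^bsub>poly_ring V\<^esub> a \<in> ideal_of G \<inter> pcarrier V"
      using ax pcarrier_mult[of x V a] by (simp add: poly_ring_def ring_module.span_scale)
    show "a \<otimes>\<^bsub>poly_ring V\<^esub> x \<in> ideal_of G \<inter> pcarrier V"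
      using ax pcarrier_mult[of a V x] by (simp add: poly_ring_def ideal_of_scale_right)
  qed
  then show "Idl\<^bsub>poly_ring V\<^esub> G \<subseteq> ideal_of G \<inter> pcarrier V"
    by (rule R.genideal_minimal) (use assms ring_module.span_superset in blast)
  show "ideal_of G \<inter> pcarrier V \<subseteq> Idl\<^bsub>poly_ring V\<^esub> G"
  proof
    fix p assume p: "p \<in> ideal_of G \<inter> pcarrier V"
    \<comment> \<open>the retraction onto \<open>K[V]\<close>\<close>
    define \<rho> where "\<rho> = subst (\<lambda>x. if x \<in> V then cvar x else (0 :: 'k cpoly))"
    have id: "\<rho> q = q" if "q \<in> pcarrier V" for q
      unfolding \<rho>_def by (rule subst_eq_self[OF that]) simp
    have carr: "\<rho> q \<in> pcarrier V" for q
      unfolding \<rho>_def by (rule subst_in_pcarrier) (auto intro: pcarrier_cvar)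
    from p have "p \<in> ideal_of G" by simp
    then have "\<rho> p \<in> Idl\<^bsub>poly_ring V\<^esub> G"
    proof (induction rule: ring_module.span_induct_alt)
      case base
      show ?case using J.zero_closed by (simp add: \<rho>_def poly_ring_def)
    next
      case (step c g y)
      have "g \<in> Idl\<^bsub>poly_ring V\<^esub> G" using step R.genideal_self[OF assms] by blast
      then have "\<rho> c * g \<in> Idl\<^bsub>poly_ring V\<^esub> G"
        using J.I_l_closed[OF _ carr, of g c] by (simp add: poly_ring_def)
      then have "\<rho> c * g + \<rho> y \<in> Idl\<^bsub>poly_ring V\<^esub> G"
        using J.a_closed[OF _ step.IH, of "\<rho> c * g"] by (simp add: poly_ring_def)
      moreover have "\<rho> g = g" using step assms by (intro id) auto
      then have "\<rho> (c * g + y) = \<rho> c * g + \<rho> y" by (simp add: \<rho>_def)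
      ultimately show ?case by simp
    qed
    then show "p \<in> Idl\<^bsub>poly_ring V\<^esub> G" using id p by simp
  qed
qed

lemma genideal_poly_ring_sum:
  fixes G H :: "'k::field cpoly set"
  assumes "G \<subseteq> pcarrier V" "H \<subseteq> pcarrier V"
  shows "Idl\<^bsub>poly_ring V\<^esub> G <+>\<^bsub>poly_ring V\<^esub> Idl\<^bsub>poly_ring V\<^esub> H
    = ideal_of (G \<union> H) \<inter> pcarrier V"
proof -
  interpret R: ring "poly_ring V :: 'k cpoly ring" by (rule ring_poly_ring)
  have 1: "ideal (Idl\<^bsub>poly_ring V\<^esub> G) (poly_ring V)" "ideal (Idl\<^bsub>poly_ring V\<^esub> H) (poly_ring V)"
    using assms R.genideal_ideal by auto
  have "ideal_of G \<inter> pcarrier V \<union> ideal_of H \<inter> pcarrier V \<subseteq> ideal_of (G \<union> H)"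
    using ring_module.span_mono[of G "G \<union> H"] ring_module.span_mono[of H "G \<union> H"] by auto
  then have "ideal_of (ideal_of G \<inter> pcarrier V \<union> ideal_of H \<inter> pcarrier V) \<subseteq> ideal_of (G \<union> H)"
    by (metis ring_module.span_mono ring_module.span_span)
  moreover have "G \<union> H \<subseteq> ideal_of G \<inter> pcarrier V \<union> ideal_of H \<inter> pcarrier V"
    using assms ring_module.span_superset by blast
  then have "ideal_of (G \<union> H) \<subseteq> ideal_of (ideal_of G \<inter> pcarrier V \<union> ideal_of H \<inter> pcarrier V)"
    by (rule ring_module.span_mono)
  ultimately show ?thesis
    unfolding R.union_genideal[OF 1, symmetric] unfolding genideal_poly_ring[OF assms(1)] genideal_poly_ring[OF assms(2)]
    by (subst genideal_poly_ring) auto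
qed


section \<open>Terms and term orderings\<close>

lemma terms_iff: "t \<in> terms n \<longleftrightarrow> keys t \<subseteq> {..<n}"
  by (simp add: terms_def)

lemma terms_add_iff [simp]: "s + t \<in> terms n \<longleftrightarrow> s \<in> terms n \<and> t \<in> terms n"
  by (auto simp: terms_iff in_keys_iff lookup_add subset_iff)

lemma terms_zero [simp]: "0 \<in> terms n"
  by (simp add: terms_iff)

lemma terms_single [simp]: "k < n \<Longrightarrow> single k (Suc 0) \<in> terms n"
  by (simp add: terms_iff)

lemma terms_minus: "s \<in> terms n \<Longrightarrow> s - t \<in> terms n"
  by (auto simp: terms_iff in_keys_iff lookup_minus subset_iff)

lemma term_dvd_iff: "term_dvd s t \<longleftrightarrow> (\<forall>k. lookup s k \<le> lookup t k)"
proof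
  assume "\<forall>k. lookup s k \<le> lookup t k"
  then have "t = s + (t - s)"
    by (intro poly_mapping_eqI) (simp add: lookup_add lookup_minus)
  then show "term_dvd s t"
    unfolding term_dvd_def by blast
qed (auto simp: term_dvd_def lookup_add)

lemma term_dvd_minus: "term_dvd s t \<Longrightarrow> s + (t - s) = t"
  by (auto simp: term_dvd_def)

lemma term_dvd_minus': "term_dvd s t \<Longrightarrow> t - s + s = t"
  by (metis term_dvd_minus add.commute)

lemma term_dvd_add: "term_dvd s t \<Longrightarrow> term_dvd s (u + t)"
  unfolding term_dvd_def by (metis add.left_commute)

lemma term_dvd_add_minus: "term_dvd s t \<Longrightarrow> u + t - s = u + (t - s)"
  by (metis term_dvd_minus add.left_commute add_diff_cancel_left')

lemma term_dvd_trans: "term_dvd s t \<Longrightarrow> term_dvd t u \<Longrightarrow> term_dvd s u"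
  by (meson term_dvd_iff order_trans)

lemma term_dvd_lcm: "term_dvd s (term_lcm s t)" "term_dvd t (term_lcm s t)"
  unfolding term_dvd_iff term_lcm_def lookup_add lookup_minus by (intro allI, linarith)+

lemma term_lcm_least: "term_dvd s u \<Longrightarrow> term_dvd t u \<Longrightarrow> term_dvd (term_lcm s t) u"
  unfolding term_dvd_iff term_lcm_def lookup_add lookup_minus
  by (metis add_diff_inverse_nat add.right_neutral diff_is_0_eq' linorder_not_less order_le_less)

lemma terms_induct [consumes 1, case_names zero step]:
  assumes "t \<in> terms n" "P 0"
    and step: "\<And>k s. k < n \<Longrightarrow> s \<in> terms n \<Longrightarrow> P s \<Longrightarrow> P (single k 1 + s)"
  shows "P t"
  using assms(1)
proof (induction "\<Sum>k<n. lookup t k" arbitrary: t rule: less_induct)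
  case less
  show ?case
  proof (cases "t = 0")
    case False
    then obtain k where k: "lookup t k \<noteq> 0"
      by (metis poly_mapping_eqI lookup_zero)
    with less.prems have "k < n" using in_keys_iff[of k t] by (auto simp: terms_iff)
    have "term_dvd (single k 1) t"
      using k by (auto simp: term_dvd_iff lookup_single when_def)
    then obtain s where t: "t = single k 1 + s" by (auto simp: term_dvd_def)
    have "(\<Sum>i<n. lookup s i) < (\<Sum>i<n. lookup t i)"
      by (rule sum_strict_mono_ex1) (use \<open>k < n\<close> in \<open>auto simp: t lookup_add intro!: bexI[of _ k]\<close>)
    moreover have "s \<in> terms n" using less.prems by (simp add: t)
    ultimately show ?thesis using less.hyps[of s] step \<open>k < n\<close> t by blast
  qed (use assms(2) in simp)
qed

text \<open>A decreasing sequence of naturals is constant from the place where it attains its minimum.\<close>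

lemma nat_seq_mono_subseq:
  fixes a :: "nat \<Rightarrow> nat"
  shows "\<exists>r :: nat \<Rightarrow> nat. strict_mono r \<and> mono (\<lambda>i. a (r i))"
proof -
  obtain f where f: "strict_mono f" "monoseq (\<lambda>i. a (f i))"
    using seq_monosub[of a] by blast
  show ?thesis
  proof (cases "mono (\<lambda>i. a (f i))")
    case True
    with f(1) show ?thesis by (intro exI[of _ f] conjI)
  next
    case False
    then have dec: "antimono (\<lambda>i. a (f i))"
      using f(2) by (auto simp: monoseq_iff)
    define p where "p = (ARG_MIN (\<lambda>i. a (f i)) i. True)"
    have p: "a (f p) \<le> a (f i)" for i
      unfolding p_def by (rule arg_min_nat_le) simp
    have const: "a (f (p + i)) = a (f p)" for i
      by (rule antisym) (use dec p in \<open>auto simp: antimono_def\<close>)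
    have "strict_mono (\<lambda>i. f (p + i))"
      using f(1) by (auto simp: strict_mono_def)
    moreover have "mono (\<lambda>i. a (f (p + i)))"
      by (simp add: const mono_def)
    ultimately show ?thesis by blast
  qed
qed

text \<open>Dickson's lemma: passing to a subsequence once for each indeterminate makes all exponents
  nondecreasing simultaneously.\<close>

lemma dickson:
  fixes g :: "nat \<Rightarrow> pterm"
  assumes "\<And>i. g i \<in> terms n"
  shows "\<exists>i j. i < j \<and> term_dvd (g i) (g j)"
proof -
  have "\<exists>r :: nat \<Rightarrow> nat. strict_mono r \<and> (\<forall>k<m. mono (\<lambda>i. lookup (g (r i)) k))" for m
  proof (induction m)
    case 0
    show ?case by (intro exI[of _ "\<lambda>i. i"]) (simp add: strict_mono_def)
  next
    case (Suc m)
    then obtain r :: "nat \<Rightarrow> nat" where r: "strict_mono r" "\<forall>k<m. mono (\<lambda>i. lookup (g (r i)) k)" by blast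
    obtain r' :: "nat \<Rightarrow> nat" where r': "strict_mono r'" "mono (\<lambda>i. lookup (g (r (r' i))) m)"
      using nat_seq_mono_subseq[of "\<lambda>i. lookup (g (r i)) m"] by blast
    have "strict_mono (\<lambda>i. r (r' i))"
      using r(1) r'(1) by (auto simp: strict_mono_def)
    moreover have "mono (\<lambda>i. lookup (g (r (r' i))) k)" if "k < Suc m" for k
      using that r(2) r' strict_mono_mono[OF r'(1)]
      by (cases "k = m") (auto simp: mono_def)
    ultimately show ?case by blast
  qed
  then obtain r :: "nat \<Rightarrow> nat" where r: "strict_mono r" "\<forall>k<n. mono (\<lambda>i. lookup (g (r i)) k)" by blast
  have "r 0 < r 1" using r(1) by (simp add: strict_mono_def)
  moreover have "lookup (g (r 0)) k \<le> lookup (g (r 1)) k" for k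
  proof (cases "k < n")
    case True
    then show ?thesis using r(2) by (auto simp: mono_def)
  next
    case False
    then have "lookup (g (r 0)) k = 0"
      using assms[of "r 0"] by (auto simp: terms_iff in_keys_iff)
    then show ?thesis by simp
  qed
  ultimately show ?thesis by (auto simp: term_dvd_iff)
qed

locale term_order =
  fixes n :: nat and \<sigma> :: "pterm rel"
  assumes term_ordering: "term_ordering n \<sigma>"
begin

abbreviation less :: "pterm \<Rightarrow> pterm \<Rightarrow> bool" (infix "\<prec>" 50) where
  "s \<prec> t \<equiv> term_less \<sigma> s t"

lemma less_irrefl [simp]: "\<not> s \<prec> s"
  by (simp add: term_less_def)

lemma less_terms: "s \<prec> t \<Longrightarrow> s \<in> terms n \<and> t \<in> terms n"
  using term_ordering by (auto simp: term_less_def term_ordering_def order_on_defs)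

lemma less_trans: "s \<prec> t \<Longrightarrow> t \<prec> u \<Longrightarrow> s \<prec> u"
  using term_ordering unfolding term_less_def term_ordering_def order_on_defs
  by (metis antisymD transD)

lemma less_linear: "s \<in> terms n \<Longrightarrow> t \<in> terms n \<Longrightarrow> s \<prec> t \<or> s = t \<or> t \<prec> s"
  using term_ordering unfolding term_less_def term_ordering_def order_on_defs total_on_def
  by metis

lemma less_add: "s \<prec> t \<Longrightarrow> u \<in> terms n \<Longrightarrow> u + s \<prec> u + t"
  using less_terms[of s t] term_ordering
  by (auto simp: term_less_def term_ordering_def add.commute[of u])

lemma term_dvd_le: "term_dvd s t \<Longrightarrow> t \<in> terms n \<Longrightarrow> s = t \<or> s \<prec> t"
proof -
  assume "term_dvd s t" "t \<in> terms n"
  then obtain u where t: "t = s + u" and su: "s \<in> terms n" "u \<in> terms n"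
    by (auto simp: term_dvd_def)
  have "(0, u) \<in> \<sigma>" using term_ordering su by (simp add: term_ordering_def)
  then have "(0 + s, u + s) \<in> \<sigma>"
    using term_ordering su terms_zero[of n] unfolding term_ordering_def by blast
  then show ?thesis by (auto simp: t term_less_def add.commute)
qed

text \<open>In an infinite descending chain some member would divide a later one by Dickson's lemma, but a
  term ordering extends divisibility.\<close>

lemma wf_less: "wf {(s, t). s \<prec> t}"
  unfolding wf_iff_no_infinite_down_chain
proof
  assume "\<exists>f. \<forall>i. (f (Suc i), f i) \<in> {(s, t). s \<prec> t}"
  then obtain f where f: "\<And>i. f (Suc i) \<prec> f i" by blast
  have dec: "f (i + Suc d) \<prec> f i" for i d
  proof (induction d)
    case (Suc d)
    show ?case using less_trans[OF f[of "i + Suc d"] Suc] by simp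
  qed (use f in simp)
  have terms: "f i \<in> terms n" for i using less_terms[OF f[of i]] by simp
  obtain i j where "i < j" "term_dvd (f i) (f j)" using dickson[OF terms] by blast
  moreover from \<open>i < j\<close> obtain d where "j = i + Suc d"
    using less_iff_Suc_add by auto
  ultimately show False
    using term_dvd_le[OF _ terms[of j], of "f i"] dec[of i d] less_trans[of "f i" "f j" "f i"] by auto
qed

lemmas less_induct_term [case_names less] = wf_induct_rule[OF wf_less, simplified]

lemma finite_has_maximum:
  assumes "finite A" "A \<noteq> {}" "A \<subseteq> terms n"
  shows "\<exists>m\<in>A. \<forall>a\<in>A. a = m \<or> a \<prec> m"
  using assms
proof (induction A rule: finite_ne_induct)
  case (insert x A)
  then obtain m where m: "m \<in> A" "\<forall>a\<in>A. a = m \<or> a \<prec> m" by auto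
  consider "x \<prec> m" | "x = m" | "m \<prec> x" using less_linear insert.prems m(1) by blast
  then show ?case
    by cases (use m less_trans in \<open>(metis insert_iff)+\<close>)
qed simp

end


section \<open>Congruence modulo an ideal\<close>

definition icong :: "'a::comm_ring_1 set \<Rightarrow> 'a \<Rightarrow> 'a \<Rightarrow> bool" where
  "icong G x y \<longleftrightarrow> x - y \<in> ideal_of G"

lemma icong_refl [simp]: "icong G x x"
  by (simp add: icong_def ring_module.span_zero)

lemma icong_sym: "icong G x y \<Longrightarrow> icong G y x"
  unfolding icong_def using ring_module.span_neg[of "x - y" G] by simp

lemma icong_trans [trans]: "icong G x y \<Longrightarrow> icong G y z \<Longrightarrow> icong G x z"
  unfolding icong_def using ring_module.span_add[of "x - y" G "y - z"] by simp

lemma icong_eq_trans [trans]: "icong G x y \<Longrightarrow> y = z \<Longrightarrow> icong G x z" "x = y \<Longrightarrow> icong G y z \<Longrightarrow> icong G x z"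
  by simp_all

lemma icong_add: "icong G x y \<Longrightarrow> icong G x' y' \<Longrightarrow> icong G (x + x') (y + y')"
  unfolding icong_def using ring_module.span_add[of "x - y" G "x' - y'"] by (simp add: algebra_simps)

lemma icong_diff: "icong G x y \<Longrightarrow> icong G x' y' \<Longrightarrow> icong G (x - x') (y - y')"
  unfolding icong_def using ring_module.span_diff[of "x - y" G "x' - y'"] by (simp add: algebra_simps)

lemma icong_mult: "icong G x y \<Longrightarrow> icong G (c * x) (c * y)"
  unfolding icong_def right_diff_distrib[symmetric] by (rule ring_module.span_scale)

lemma icong_sum: "(\<And>a. a \<in> A \<Longrightarrow> icong G (f a) (g a)) \<Longrightarrow> icong G (sum f A) (sum g A)"
  by (induction A rule: infinite_finite_induct) (auto intro: icong_add)

lemma icong_zero_iff: "icong G x 0 \<longleftrightarrow> x \<in> ideal_of G"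
  by (simp add: icong_def)


section \<open>Reductions\<close>

locale prebasis_setup = term_order n \<sigma> for n :: nat and \<sigma> :: "pterm rel" +
  fixes \<mu> \<nu> \<eta> :: nat
    and \<O> :: "pterm set"
    and t b :: "nat \<Rightarrow> pterm"
  assumes order_ideal: "order_ideal n \<O>"
    and t_bij: "bij_betw t {..<\<mu>} \<O>"
    and b_bij: "bij_betw b {..<\<nu>} (border n \<O>)"
    and \<eta>_le: "\<eta> \<le> \<nu>"
    and b_corners: "b ` {..<\<eta>} = corners n \<O>"
begin

lemma O_terms: "\<O> \<subseteq> terms n"
  using order_ideal by (simp add: order_ideal_def)

lemma O_dvd_closed: "u \<in> \<O> \<Longrightarrow> term_dvd s u \<Longrightarrow> s \<in> \<O>"
  using order_ideal by (auto simp: order_ideal_def)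

lemma O_eq: "\<O> = t ` {..<\<mu>}"
  using t_bij by (simp add: bij_betw_def)

lemma t_inj: "i < \<mu> \<Longrightarrow> j < \<mu> \<Longrightarrow> t i = t j \<longleftrightarrow> i = j"
  using t_bij by (auto simp: bij_betw_def inj_on_def)

lemma t_in_O: "i < \<mu> \<Longrightarrow> t i \<in> \<O>"
  by (simp add: O_eq)

lemma t_terms: "i < \<mu> \<Longrightarrow> t i \<in> terms n"
  using t_in_O O_terms by blast

lemma b_inj: "i < \<nu> \<Longrightarrow> j < \<nu> \<Longrightarrow> b i = b j \<longleftrightarrow> i = j"
  using b_bij by (auto simp: bij_betw_def inj_on_def)

lemma b_notin_O: "j < \<nu> \<Longrightarrow> b j \<notin> \<O>"
  using b_bij by (auto simp: bij_betw_def border_def)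

lemma b_border: "j < \<nu> \<Longrightarrow> \<exists>k<n. \<exists>i<\<mu>. b j = single k 1 + t i"
proof -
  assume "j < \<nu>"
  then have "b j \<in> border n \<O>" using b_bij by (auto simp: bij_betw_def)
  then show ?thesis unfolding border_def O_eq by blast
qed

lemma b_terms: "j < \<nu> \<Longrightarrow> b j \<in> terms n"
  using b_border[of j] t_terms by auto

lemma dvd_by_b_notin_O: "j < \<eta> \<Longrightarrow> term_dvd (b j) u \<Longrightarrow> u \<notin> \<O>"
  using O_dvd_closed b_notin_O \<eta>_le by (meson order_less_le_trans)

text \<open>Descending to proper divisors outside \<open>\<O>\<close> ends at a minimal one, because divisors are smaller
  in the term ordering.\<close>

lemma corner_dvd_exists:
  assumes "u \<in> terms n" "u \<notin> \<O>"
  shows "\<exists>j<\<eta>. term_dvd (b j) u"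
  using assms
proof (induction u rule: less_induct_term)
  case (less u)
  show ?case
  proof (cases "u \<in> corners n \<O>")
    case True
    then obtain j where "j < \<eta>" "u = b j" using b_corners by auto
    then show ?thesis by (auto simp: term_dvd_iff)
  next
    case False
    then obtain s where s: "s \<in> terms n" "s \<notin> \<O>" "term_dvd s u" "s \<noteq> u"
      using less.prems by (auto simp: corners_def)
    then have "s \<prec> u" using term_dvd_le less.prems by blast
    then show ?thesis using less.IH s term_dvd_trans by blast
  qed
qed

definition tails :: "nat \<Rightarrow> nat set" where
  "tails j = {l. l < \<mu> \<and> t l \<prec> b j}"

lemma finite_tails [simp]: "finite (tails j)"
  by (simp add: tails_def)

lemma tailsD: "l \<in> tails j \<Longrightarrow> l < \<mu>" "l \<in> tails j \<Longrightarrow> t l \<prec> b j"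
  by (simp_all add: tails_def)

text \<open>If \<open>b\<^sub>j\<close> divides \<open>v\<close>, this is the value of the linear extension of \<open>F\<close> at the polynomial that
  replaces \<open>v\<close> in a reduction step with \<open>g\<^sub>j\<close>.\<close>

definition tail_sum :: "(pterm \<Rightarrow> 'k::field cpoly) \<Rightarrow> pterm \<Rightarrow> nat \<Rightarrow> 'k cpoly" where
  "tail_sum F v j = (\<Sum>l\<in>tails j. cvar (l, j) * F (v - b j + t l))"

lemma tail_sum_shift:
  assumes "term_dvd (b j) v"
  shows "tail_sum (\<lambda>u. F (w + u)) v j = tail_sum F (w + v) j"
  using assms by (simp add: tail_sum_def term_dvd_add_minus add.assoc)

lemma replaced_term_less:
  assumes "v \<in> terms n" "term_dvd (b j) v" "l \<in> tails j"
  shows "v - b j + t l \<prec> v"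
  using less_add[OF tailsD(2)[OF assms(3)], of "v - b j"] terms_minus[OF assms(1)]
    term_dvd_minus'[OF assms(2)] by simp

lemma single_mult_prebasis:
  "single w c * prebasis \<sigma> \<mu> t b j =
    single (w + b j) c - (\<Sum>l\<in>tails j. single (w + t l) (c * cvar (l, j)))"
  by (simp add: prebasis_def tails_def right_diff_distrib mult_single sum_distrib_left)

lemma linear_ext_single_mult_prebasis:
  assumes "term_dvd (b j) v"
  shows "linear_ext F (single (v - b j) c * prebasis \<sigma> \<mu> t b j) = c * (F v - tail_sum F v j)"
  unfolding single_mult_prebasis term_dvd_minus'[OF assms] tail_sum_def
    linear_ext_diff linear_ext_sum linear_ext_single right_diff_distrib sum_distrib_left mult.assoc ..

lemma keys_single_mult_prebasis:
  assumes "term_dvd (b j) v"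
  shows "keys (single (v - b j) c * prebasis \<sigma> \<mu> t b j)
    \<subseteq> insert v ((\<lambda>l. v - b j + t l) ` tails j)"
proof -
  have "keys (\<Sum>l\<in>tails j. single (v - b j + t l) (c * cvar (l, j)))
      \<subseteq> (\<lambda>l. v - b j + t l) ` tails j"
    by (rule order_trans[OF Poly_Mapping.keys_sum]) (auto split: if_splits)
  then show ?thesis
    unfolding single_mult_prebasis term_dvd_minus'[OF assms]
    by (intro order_trans[OF keys_diff] Un_least) (auto split: if_splits)
qed

text \<open>Modulo \<open>G\<close>, the linear extension of \<open>F\<close> vanishes on every multiple of some \<open>g\<^sub>j\<close> by a term
  that has its leading term in \<open>U\<close>. Bounding the leading terms is what makes Buchberger's induction
  along the term ordering possible.\<close>

definition respects_prebasis :: "pterm set \<Rightarrow> 'k::field cpoly set \<Rightarrow> (pterm \<Rightarrow> 'k cpoly) \<Rightarrow> bool" where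
  "respects_prebasis U G F \<longleftrightarrow>
     (\<forall>v\<in>U. \<forall>j<\<eta>. term_dvd (b j) v \<longrightarrow> icong G (F v) (tail_sum F v j))"

lemma respects_prebasisD:
  "respects_prebasis U G F \<Longrightarrow> v \<in> U \<Longrightarrow> j < \<eta> \<Longrightarrow> term_dvd (b j) v \<Longrightarrow> icong G (F v) (tail_sum F v j)"
  by (simp add: respects_prebasis_def)

lemma reduction_icong:
  assumes red: "(red_step \<sigma> \<mu> \<eta> t b)\<^sup>*\<^sup>* f h"
    and "keys f \<subseteq> U"
    and closed: "\<And>v j l. v \<in> U \<Longrightarrow> j < \<eta> \<Longrightarrow> term_dvd (b j) v \<Longrightarrow> l \<in> tails j \<Longrightarrow> v - b j + t l \<in> U"
    and resp: "respects_prebasis U G F"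
  shows "icong G (linear_ext F f) (linear_ext F h)"
proof -
  have "keys h \<subseteq> U \<and> icong G (linear_ext F f) (linear_ext F h)"
    using red
  proof (induction rule: rtranclp_induct)
    case base
    show ?case using assms(2) by simp
  next
    case (step p q)
    then obtain u j where u: "lookup p u \<noteq> 0" and j: "j < \<eta>" "term_dvd (b j) u"
      and q: "q = p - single (u - b j) (lookup p u) * prebasis \<sigma> \<mu> t b j"
      by (auto simp: red_step_def)
    have uU: "u \<in> U" using u step.IH by (auto simp: in_keys_iff)
    have "keys q \<subseteq> U"
      using keys_single_mult_prebasis[OF j(2), of "lookup p u"] closed[OF uU j] uU step.IH
        keys_diff[of p "single (u - b j) (lookup p u) * prebasis \<sigma> \<mu> t b j"]
      unfolding q by blast
    moreover have "icong G (lookup p u * (F u - tail_sum F u j)) (lookup p u * 0)"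
      by (rule icong_mult) (use resp uU j in \<open>auto simp: respects_prebasis_def icong_def\<close>)
    then have "icong G (linear_ext F p - 0) (linear_ext F q)"
      unfolding q linear_ext_diff linear_ext_single_mult_prebasis[OF j(2)]
      by (intro icong_diff) (auto intro: icong_sym)
    ultimately show ?case using step.IH icong_trans by auto
  qed
  then show ?thesis by simp
qed

text \<open>The two copies of the least common multiple cancel, so only the tails remain; hence all terms of
  an S-polynomial are smaller than the least common multiple.\<close>

lemma S_poly_eq:
  "S_poly \<sigma> \<mu> t b j k =
    (\<Sum>l\<in>tails k. single (term_lcm (b j) (b k) - b k + t l) (cvar (l, k)))
    - (\<Sum>l\<in>tails j. single (term_lcm (b j) (b k) - b j + t l) (cvar (l, j)))"
  by (simp add: S_poly_def single_mult_prebasis term_dvd_minus' term_dvd_lcm)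

lemma linear_ext_S_poly:
  "linear_ext F (S_poly \<sigma> \<mu> t b j k) =
    tail_sum F (term_lcm (b j) (b k)) k - tail_sum F (term_lcm (b j) (b k)) j"
  by (simp add: S_poly_eq tail_sum_def)

lemma term_lcm_terms: "s \<in> terms n \<Longrightarrow> u \<in> terms n \<Longrightarrow> term_lcm s u \<in> terms n"
  by (simp add: term_lcm_def terms_minus)

lemma keys_S_poly:
  assumes "j < \<eta>" "k < \<eta>"
  shows "keys (S_poly \<sigma> \<mu> t b j k) \<subseteq> {v. v \<prec> term_lcm (b j) (b k)}"
proof -
  let ?L = "term_lcm (b j) (b k)"
  have L: "?L \<in> terms n"
    using assms \<eta>_le by (intro term_lcm_terms b_terms) auto
  have *: "keys (\<Sum>l\<in>tails i. single (?L - b i + t l) (cvar (l, i))) \<subseteq> {v. v \<prec> ?L}"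
    if "term_dvd (b i) ?L" for i
    by (rule order_trans[OF Poly_Mapping.keys_sum])
      (use replaced_term_less[OF L that] in \<open>auto split: if_splits\<close>)
  show ?thesis
    unfolding S_poly_eq
    by (intro order_trans[OF keys_diff] Un_least *[OF term_dvd_lcm(1)] *[OF term_dvd_lcm(2)])
qed

lemma keys_S_poly_terms:
  assumes "j < \<eta>" "k < \<eta>"
  shows "keys (S_poly \<sigma> \<mu> t b j k) \<subseteq> terms n"
  using keys_S_poly[OF assms] less_terms by blast

text \<open>Rewriting the largest term outside \<open>\<O>\<close> removes it and creates only smaller terms, so
  the process of always doing this ends by well-foundedness.\<close>

lemma reduces_completely_exists:
  fixes f :: "'k::field xpoly"
  assumes "keys f \<subseteq> terms n"
  shows "\<exists>h. reduces_completely \<sigma> \<mu> \<eta> t b f h"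
proof -
  have by_maximum: "\<exists>h. reduces_completely \<sigma> \<mu> \<eta> t b f h"
    if "keys f \<subseteq> terms n"
      and IH: "\<And>m. m \<in> keys f - \<O> \<Longrightarrow> (\<And>v. v \<in> keys f - \<O> \<Longrightarrow> v = m \<or> v \<prec> m)
        \<Longrightarrow> \<exists>h. reduces_completely \<sigma> \<mu> \<eta> t b f h"
    for f :: "'k xpoly"
  proof (cases "keys f - \<O> = {}")
    case True
    then have "reduces_completely \<sigma> \<mu> \<eta> t b f f"
      by (auto simp: reduces_completely_def O_eq)
    then show ?thesis by blast
  next
    case False
    then obtain m where "m \<in> keys f - \<O>" "\<forall>a\<in>keys f - \<O>. a = m \<or> a \<prec> m"
      using finite_has_maximum[of "keys f - \<O>"] \<open>keys f \<subseteq> terms n\<close> by auto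
    then show ?thesis using IH[of m] by blast
  qed
  have main: "\<exists>h. reduces_completely \<sigma> \<mu> \<eta> t b f h"
    if "keys f \<subseteq> terms n" "\<And>v. v \<in> keys f - \<O> \<Longrightarrow> v = u \<or> v \<prec> u" for u and f :: "'k xpoly"
    using that
  proof (induction u arbitrary: f rule: less_induct_term)
    case (less u)
    show ?case
    proof (cases "u \<in> keys f - \<O>")
      case False
      then have lt: "v \<prec> u" if "v \<in> keys f - \<O>" for v
        using less.prems(2)[OF that] that by auto
      show ?thesis
        by (rule by_maximum[OF less.prems(1)]) (rule less.IH[OF lt less.prems(1)])
    next
      case True
      then obtain j where j: "j < \<eta>" "term_dvd (b j) u"
        using corner_dvd_exists less.prems(1) by blast
      have u: "u \<in> terms n" using True less.prems(1) by blast
      define g where "g = single (u - b j) (lookup f u) * prebasis \<sigma> \<mu> t b j"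
      have step: "red_step \<sigma> \<mu> \<eta> t b f (f - g)"
        unfolding red_step_def g_def using True j by (auto simp: in_keys_iff)
      have g_keys: "v = u \<or> v \<prec> u" if "v \<in> keys g" for v
        using that keys_single_mult_prebasis[OF j(2), of "lookup f u"] replaced_term_less[OF u j(2)]
        unfolding g_def by blast
      have "lookup g u = lookup f u"
      proof -
        have "lookup (single (v - b j + t l) c) u = 0" if "l \<in> tails j" "v = u" for l v and c :: "'k cpoly"
          using replaced_term_less[OF u j(2) that(1)] that(2) by (auto simp: lookup_single when_def)
        then show ?thesis
          unfolding g_def single_mult_prebasis term_dvd_minus'[OF j(2)]
          by (simp add: lookup_minus lookup_sum)
      qed
      then have nu: "u \<notin> keys (f - g)" by (simp add: in_keys_iff lookup_minus)
      have kd: "keys (f - g) \<subseteq> keys f \<union> keys g" by (rule keys_diff)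
      have terms: "keys (f - g) \<subseteq> terms n"
        using kd less.prems(1) g_keys u less_terms by blast
      have lt: "v \<prec> u" if "v \<in> keys (f - g) - \<O>" for v
        using that kd g_keys[of v] less.prems(2)[of v] nu by blast
      have "\<exists>h. reduces_completely \<sigma> \<mu> \<eta> t b (f - g) h"
        by (rule by_maximum[OF terms]) (rule less.IH[OF lt terms])
      then show ?thesis
        using step unfolding reduces_completely_def
        by (meson converse_rtranclp_into_rtranclp)
    qed
  qed
  show ?thesis
    by (rule by_maximum[OF assms]) (rule main[OF assms])
qed

abbreviation "S_corners \<equiv> S_set \<sigma> \<mu> t b \<eta>"

definition coeffs_in :: "(nat \<times> nat) set \<Rightarrow> 'k::field xpoly \<Rightarrow> bool" where
  "coeffs_in V f \<longleftrightarrow> (\<forall>u. lookup f u \<in> pcarrier V)"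

lemma coeffs_in_single: "c \<in> pcarrier V \<Longrightarrow> coeffs_in V (single u c)"
  by (simp add: coeffs_in_def lookup_single when_def)

lemma coeffs_in_diff: "coeffs_in V f \<Longrightarrow> coeffs_in V g \<Longrightarrow> coeffs_in V (f - g)"
  by (simp add: coeffs_in_def lookup_minus pcarrier_diff)

lemma coeffs_in_sum: "(\<And>a. a \<in> A \<Longrightarrow> coeffs_in V (f a)) \<Longrightarrow> coeffs_in V (sum f A)"
  by (simp add: coeffs_in_def lookup_sum pcarrier_sum)

lemma tail_cvar_carrier: "j < \<eta> \<Longrightarrow> l \<in> tails j \<Longrightarrow> cvar (l, j) \<in> pcarrier S_corners"
  by (rule pcarrier_cvar) (auto simp: S_set_def tails_def)

lemma coeffs_in_single_mult_prebasis:
  assumes "c \<in> pcarrier S_corners" "j < \<eta>"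
  shows "coeffs_in S_corners (single w c * prebasis \<sigma> \<mu> t b j)"
  unfolding single_mult_prebasis
  by (intro coeffs_in_diff coeffs_in_sum coeffs_in_single pcarrier_mult tail_cvar_carrier assms)

lemma coeffs_in_S_poly: "j < \<eta> \<Longrightarrow> k < \<eta> \<Longrightarrow> coeffs_in S_corners (S_poly \<sigma> \<mu> t b j k)"
  unfolding S_poly_def by (intro coeffs_in_diff coeffs_in_single_mult_prebasis) auto

lemma coeffs_in_reduction:
  assumes "(red_step \<sigma> \<mu> \<eta> t b)\<^sup>*\<^sup>* f h" "coeffs_in S_corners f"
  shows "coeffs_in S_corners h"
  using assms
proof (induction rule: rtranclp_induct)
  case (step p q)
  then have "coeffs_in S_corners p" by simp
  then have "lookup p u \<in> pcarrier S_corners" for u by (simp add: coeffs_in_def)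
  with step.hyps(2) \<open>coeffs_in S_corners p\<close> show ?case
    unfolding red_step_def
    by (elim exE conjE) (simp add: coeffs_in_diff coeffs_in_single_mult_prebasis)
qed

section \<open>Normal forms\<close>

definition chosen :: "pterm \<Rightarrow> nat" where
  "chosen u = (SOME j. j < \<eta> \<and> term_dvd (b j) u)"

lemma chosen:
  assumes "u \<in> terms n" "u \<notin> \<O>"
  shows "chosen u < \<eta>" "term_dvd (b (chosen u)) u"
  using someI_ex[OF corner_dvd_exists[OF assms]] by (simp_all add: chosen_def)

text \<open>The recursion fixes one corner for each term, so that \<open>nf i\<close> kills the multiples of \<open>g\<^sub>j\<close> for the
  chosen corners exactly, and only the other corners involve \<open>J\<close>. Picking an arbitrary
  complete reduction of each term instead would give values without any such relation between them.\<close>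

definition nf :: "nat \<Rightarrow> pterm \<Rightarrow> 'k::field cpoly" where
  "nf i = wfrec {(s, u). s \<prec> u}
     (\<lambda>N u. if u \<in> \<O> then if u = t i then 1 else 0 else tail_sum N u (chosen u))"

lemma nf_in_O: "u \<in> \<O> \<Longrightarrow> nf i u = (if u = t i then 1 else 0)"
  unfolding nf_def by (subst wfrec[OF wf_less]) simp

lemma nf_t: "l < \<mu> \<Longrightarrow> i < \<mu> \<Longrightarrow> nf i (t l) = (if l = i then 1 else 0)"
  by (simp add: nf_in_O t_in_O t_inj)

lemma nf_rec:
  assumes "u \<in> terms n" "u \<notin> \<O>"
  shows "nf i u = tail_sum (nf i) u (chosen u)"
proof -
  have "tail_sum (cut (nf i) {(s, u). s \<prec> u} u) u (chosen u) = tail_sum (nf i) u (chosen u)"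
    unfolding tail_sum_def
    by (rule sum.cong) (use replaced_term_less[OF assms(1) chosen(2)[OF assms]] in \<open>auto simp: cut_apply\<close>)
  then show ?thesis
    unfolding nf_def by (subst wfrec[OF wf_less]) (use assms in simp)
qed

lemma nf_nonzero_le:
  assumes "u \<in> terms n" "(nf i u :: 'k::field cpoly) \<noteq> 0"
  shows "t i = u \<or> t i \<prec> u"
  using assms
proof (induction u rule: less_induct_term)
  case (less u)
  show ?case
  proof (cases "u \<in> \<O>")
    case True
    then show ?thesis using less.prems by (auto simp: nf_in_O split: if_splits)
  next
    case False
    then have "(tail_sum (nf i) u (chosen u) :: 'k cpoly) \<noteq> 0"
      using less.prems by (simp add: nf_rec)
    then obtain l where l: "l \<in> tails (chosen u)" "(nf i (u - b (chosen u) + t l) :: 'k cpoly) \<noteq> 0"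
      unfolding tail_sum_def by (metis (no_types, lifting) sum.neutral mult_zero_right)
    have "u - b (chosen u) + t l \<prec> u"
      using replaced_term_less[OF less.prems(1) chosen(2)[OF less.prems(1) False] l(1)] .
    then show ?thesis using less.IH[OF _ _ l(2)] less_terms less_trans by metis
  qed
qed

text \<open>A corner is divisible by no other corner, so its normal form is the tail of its own \<open>g\<^sub>j\<close>. Thus the
  substitution of normal forms leaves the indeterminates of \<open>R\<close> alone.\<close>

lemma nf_corner:
  assumes "i < \<mu>" "j < \<eta>"
  shows "nf i (b j) = (if t i \<prec> b j then cvar (i, j) else (0 :: 'k::field cpoly))"
proof -
  have j: "j < \<nu>" using assms \<eta>_le by simp
  have bj: "b j \<in> terms n" "b j \<notin> \<O>" using b_terms b_notin_O j by auto
  define j' where "j' = chosen (b j)"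
  have j': "j' < \<eta>" "term_dvd (b j') (b j)" using chosen[OF bj] by (simp_all add: j'_def)
  have j'\<nu>: "j' < \<nu>" using j'(1) \<eta>_le by simp
  have "b j \<in> corners n \<O>" using b_corners assms(2) by blast
  then have "b j' = b j"
    using j' b_terms[OF j'\<nu>] b_notin_O[OF j'\<nu>] by (auto simp: corners_def)
  then have "j' = j" using b_inj j j'\<nu> by blast
  then have "nf i (b j) = (\<Sum>l\<in>tails j. cvar (l, j) * nf i (t l) :: 'k cpoly)"
    using nf_rec[OF bj, of i] by (simp add: j'_def tail_sum_def)
  also have "\<dots> = (\<Sum>l\<in>tails j. if l = i then cvar (l, j) else 0)"
    by (rule sum.cong) (use assms in \<open>auto simp: nf_t tailsD(1)\<close>)
  also have "\<dots> = (if t i \<prec> b j then cvar (i, j) else 0)"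
    using assms by (simp add: sum.delta' tails_def)
  finally show ?thesis .
qed

abbreviation reduction_gens :: "(nat \<Rightarrow> nat \<Rightarrow> 'k::field xpoly) \<Rightarrow> 'k cpoly set" where
  "reduction_gens h \<equiv> {lookup (h j k) (t i) | j k i. j < k \<and> k < \<eta> \<and> i < \<mu>}"

lemma linear_ext_reduced:
  assumes "keys p \<subseteq> t ` {..<\<mu>}"
  shows "linear_ext F p = (\<Sum>i<\<mu>. lookup p (t i) * F (t i))"
proof -
  have "linear_ext F p = (\<Sum>u\<in>t ` {..<\<mu>}. lookup p u * F u)"
    by (rule linear_ext_superset) (use assms in auto)
  also have "\<dots> = (\<Sum>i<\<mu>. lookup p (t i) * F (t i))"
    by (subst sum.reindex) (use t_bij in \<open>auto simp: bij_betw_def\<close>)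
  finally show ?thesis .
qed

text \<open>Buchberger's criterion, with coefficients modulo \<open>J\<close> instead of in a field. For a term \<open>v\<close>
  divisible by two corners, the difference of the two ways of rewriting \<open>v\<close> is a multiple of an
  S-polynomial. Its reduction only uses multiples of the \<open>g\<^sub>j\<close> with leading terms below \<open>v\<close>, which are
  covered by induction, and ends in a combination of terms with coefficients in \<open>J\<close>.\<close>

lemma respects_prebasis_nf:
  fixes h :: "nat \<Rightarrow> nat \<Rightarrow> 'k::field xpoly"
  assumes h: "\<And>j k. j < k \<Longrightarrow> k < \<eta> \<Longrightarrow> reduces_completely \<sigma> \<mu> \<eta> t b (S_poly \<sigma> \<mu> t b j k) (h j k)"
  shows "respects_prebasis (terms n) (reduction_gens h) (nf i)"
proof -
  let ?G = "reduction_gens h"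
  have "icong ?G (nf i v) (tail_sum (nf i) v j)"
    if "v \<in> terms n" "j < \<eta>" "term_dvd (b j) v" for v j
    using that
  proof (induction v arbitrary: j rule: less_induct_term)
    case (less v)
    have "v \<notin> \<O>" using dvd_by_b_notin_O less.prems by blast
    note ch = chosen[OF less.prems(1) \<open>v \<notin> \<O>\<close>]
    have critical: "icong ?G (tail_sum (nf i) v k) (tail_sum (nf i) v l)"
      if kl: "l < k" "k < \<eta>" "term_dvd (b k) v" "term_dvd (b l) v" for k l
    proof -
      define L where "L = term_lcm (b l) (b k)"
      have dL: "term_dvd (b l) L" "term_dvd (b k) L"
        unfolding L_def by (rule term_dvd_lcm)+
      obtain w where w: "v = w + L"
        using term_lcm_least[OF kl(4,3)] by (metis L_def term_dvd_minus')
      have wt: "w \<in> terms n" "L \<in> terms n" using less.prems(1) by (simp_all add: w)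
      \<comment> \<open>composing with multiplication by \<open>w\<close> transports the reduction of the S-polynomial itself\<close>
      define F where "F = (\<lambda>u. nf i (w + u) :: 'k cpoly)"
      have shift: "tail_sum F s m = tail_sum (nf i) (w + s) m" if "term_dvd (b m) s" for s m
        unfolding F_def by (rule tail_sum_shift[OF that])
      have red: "(red_step \<sigma> \<mu> \<eta> t b)\<^sup>*\<^sup>* (S_poly \<sigma> \<mu> t b l k) (h l k)"
        and hk: "keys (h l k) \<subseteq> t ` {..<\<mu>}"
        using h[OF kl(1,2)] by (simp_all add: reduces_completely_def)
      have "respects_prebasis {s. s \<prec> L} ?G F"
        unfolding respects_prebasis_def
      proof (intro ballI allI impI)
        fix s m assume s: "s \<in> {s. s \<prec> L}" and m: "m < \<eta>" "term_dvd (b m) s"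
        have lt: "w + s \<prec> v" unfolding w using s wt less_add by simp
        have "icong ?G (nf i (w + s)) (tail_sum (nf i) (w + s) m)"
          using less.IH[OF lt _ m(1) term_dvd_add[OF m(2)]] lt less_terms by blast
        then show "icong ?G (F s) (tail_sum F s m)"
          unfolding shift[OF m(2)] by (simp add: F_def)
      qed
      moreover have "keys (S_poly \<sigma> \<mu> t b l k :: 'k xpoly) \<subseteq> {s. s \<prec> L}"
        unfolding L_def by (rule keys_S_poly) (use kl in simp_all)
      ultimately have "icong ?G (linear_ext F (S_poly \<sigma> \<mu> t b l k)) (linear_ext F (h l k))"
        using replaced_term_less less_terms less_trans
        by (intro reduction_icong[OF red]) blast+
      moreover have "linear_ext F (h l k) \<in> ideal_of ?G"
        unfolding linear_ext_reduced[OF hk]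
        by (rule ring_module.span_sum, rule ideal_of_scale_right, rule ring_module.span_base)
          (use kl in blast)
      ultimately have "icong ?G (linear_ext F (S_poly \<sigma> \<mu> t b l k)) 0"
        using icong_trans icong_zero_iff by blast
      then show ?thesis
        unfolding linear_ext_S_poly L_def[symmetric] shift[OF dL(1)] shift[OF dL(2)] w icong_def by simp
    qed
    have "icong ?G (tail_sum (nf i) v (chosen v)) (tail_sum (nf i) v j)"
      using critical[of j "chosen v"] critical[of "chosen v" j] icong_sym less.prems ch
      by (cases j "chosen v" rule: linorder_cases) auto
    then show ?case
      unfolding nf_rec[OF less.prems(1) \<open>v \<notin> \<O>\<close>] .
  qed
  then show ?thesis by (simp add: respects_prebasis_def)
qed

text \<open>The normal form of \<open>x\<^sub>k u\<close> can be computed from the normal form of \<open>u\<close>: each rewriting step of \<open>u\<close>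
  yields one of \<open>x\<^sub>k u\<close> with the same corner. That corner need not be the one chosen for \<open>x\<^sub>k u\<close>, so the
  equation only holds modulo the ideal.\<close>

lemma nf_multiplicative:
  fixes G :: "'k::field cpoly set"
  assumes resp: "respects_prebasis (terms n) G (nf i)" and k: "k < n" and i: "i < \<mu>"
    and "u \<in> terms n"
  shows "icong G (\<Sum>m<\<mu>. nf i (single k 1 + t m) * nf m u) (nf i (single k 1 + u))"
  using \<open>u \<in> terms n\<close>
proof (induction u rule: less_induct_term)
  case (less u)
  show ?case
  proof (cases "u \<in> \<O>")
    case True
    then obtain m where m: "u = t m" "m < \<mu>" by (auto simp: O_eq)
    have "(\<Sum>l<\<mu>. nf i (single k 1 + t l) * nf l u)
        = (\<Sum>l<\<mu>. if l = m then nf i (single k 1 + t l) else (0 :: 'k cpoly))"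
      by (rule sum.cong) (use m in \<open>auto simp: nf_t\<close>)
    then show ?thesis using m by simp
  next
    case False
    let ?j = "chosen u"
    let ?u = "\<lambda>l. u - b ?j + t l"
    note j = chosen[OF less.prems False]
    have "(\<Sum>m<\<mu>. nf i (single k 1 + t m) * nf m u)
        = (\<Sum>m<\<mu>. \<Sum>l\<in>tails ?j. cvar (l, ?j) * (nf i (single k 1 + t m) * nf m (?u l) :: 'k cpoly))"
      unfolding nf_rec[OF less.prems False] tail_sum_def sum_distrib_left
      by (simp only: mult.left_commute)
    also have "\<dots> = (\<Sum>l\<in>tails ?j. cvar (l, ?j) * (\<Sum>m<\<mu>. nf i (single k 1 + t m) * nf m (?u l)))"
      unfolding sum_distrib_left by (rule sum.swap)
    also have "icong G \<dots> (\<Sum>l\<in>tails ?j. cvar (l, ?j) * nf i (single k 1 + ?u l))"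
      using replaced_term_less[OF less.prems j(2)] less_terms less.IH
      by (intro icong_sum icong_mult) blast
    also have "\<dots> = tail_sum (nf i) (single k 1 + u) ?j"
      unfolding tail_sum_shift[OF j(2), symmetric] by (simp add: tail_sum_def)
    also have "icong G \<dots> (nf i (single k 1 + u))"
      using k less.prems j
      by (intro icong_sym[OF respects_prebasisD[OF resp]] term_dvd_add) auto
    finally show ?thesis .
  qed
qed

section \<open>The multiplication matrices modulo the defining relations\<close>

abbreviation mult_matrix :: "nat \<Rightarrow> 'k::field cpoly mat" where
  "mult_matrix \<equiv> gen_mult_matrix \<mu> \<nu> t b"

lemma mult_matrix_entry_in:
  assumes "i < \<mu>" "j < \<mu>" "single k 1 + t j \<in> \<O>"
  shows "mult_matrix k $$ (i, j) = (if t i = single k 1 + t j then 1 else 0)"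
proof -
  obtain m where m: "m < \<mu>" "single k 1 + t j = t m"
    using assms(3) by (auto simp: O_eq)
  have "the_inv_into {..<\<mu>} t (t m) = m"
    by (rule the_inv_into_f_f) (use t_bij m in \<open>auto simp: bij_betw_def\<close>)
  then show ?thesis
    using assms m by (simp add: gen_mult_matrix_def Let_def t_inj del: One_nat_def)
qed

lemma mult_matrix_entry_border:
  assumes "i < \<mu>" "j < \<mu>" "m < \<nu>" "single k 1 + t j = b m"
  shows "mult_matrix k $$ (i, j) = cvar (i, m)"
proof -
  have "the_inv_into {..<\<nu>} b (b m) = m"
    by (rule the_inv_into_f_f) (use b_bij assms(3) in \<open>auto simp: bij_betw_def\<close>)
  moreover have "b m \<notin> t ` {..<\<mu>}" using b_notin_O[OF assms(3)] by (simp add: O_eq)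
  ultimately show ?thesis
    using assms by (simp add: gen_mult_matrix_def Let_def del: One_nat_def)
qed

lemma border_index:
  assumes "k < n" "j < \<mu>" "single k 1 + t j \<notin> \<O>"
  obtains m where "m < \<nu>" "single k 1 + t j = b m"
proof -
  have "single k 1 + t j \<in> border n \<O>"
    unfolding border_def using assms t_in_O by blast
  then show ?thesis using b_bij that by (auto simp: bij_betw_def)
qed

lemma mult_matrix_commutator:
  assumes "i < \<mu>" "j < \<mu>"
  shows "(mult_matrix k * mult_matrix l - mult_matrix l * mult_matrix k :: 'k::field cpoly mat) $$ (i, j) =
    (\<Sum>m<\<mu>. mult_matrix k $$ (i, m) * mult_matrix l $$ (m, j))
    - (\<Sum>m<\<mu>. mult_matrix l $$ (i, m) * mult_matrix k $$ (m, j))"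
proof -
  have [simp]: "dim_row (mult_matrix k :: 'k cpoly mat) = \<mu>" "dim_col (mult_matrix k :: 'k cpoly mat) = \<mu>" for k
    by (simp_all add: gen_mult_matrix_def)
  show ?thesis
    using assms by (simp add: scalar_prod_def lessThan_atLeast0)
qed

abbreviation commutator_gens :: "'k::field cpoly set" where
  "commutator_gens \<equiv>
    {(mult_matrix k * mult_matrix l - mult_matrix l * mult_matrix k) $$ (i, j)
      | k l i j. k < l \<and> l < n \<and> i < \<mu> \<and> j < \<mu>}"

abbreviation vanishing_gens :: "'k::field cpoly set" where
  "vanishing_gens \<equiv> cvar ` (all_c \<mu> \<nu> - S_set \<sigma> \<mu> t b \<nu>)"

abbreviation scheme_gens :: "'k::field cpoly set" where
  "scheme_gens \<equiv> vanishing_gens \<union> commutator_gens"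

text \<open>Vectors of length \<open>\<mu>\<close> are encoded as functions on all indices, so congruence of vectors
  compares the values below \<open>\<mu>\<close>.\<close>

definition mat_apply :: "nat \<Rightarrow> (nat \<Rightarrow> 'k::field cpoly) \<Rightarrow> nat \<Rightarrow> 'k cpoly" where
  "mat_apply k v i = (\<Sum>j<\<mu>. mult_matrix k $$ (i, j) * v j)"

definition vcong :: "(nat \<Rightarrow> 'k::field cpoly) \<Rightarrow> (nat \<Rightarrow> 'k cpoly) \<Rightarrow> bool" where
  "vcong v w \<longleftrightarrow> (\<forall>i<\<mu>. icong scheme_gens (v i) (w i))"

lemma vcongD: "vcong v w \<Longrightarrow> i < \<mu> \<Longrightarrow> icong scheme_gens (v i) (w i)"
  by (simp add: vcong_def)

lemma vcong_refl [simp]: "vcong v v"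
  by (simp add: vcong_def)

lemma vcong_sym: "vcong v w \<Longrightarrow> vcong w v"
  by (simp add: vcong_def icong_sym)

lemma vcong_trans [trans]: "vcong u v \<Longrightarrow> vcong v w \<Longrightarrow> vcong u w"
  unfolding vcong_def using icong_trans by blast

lemma vcong_eq_trans [trans]: "vcong u v \<Longrightarrow> v = w \<Longrightarrow> vcong u w"
  by simp

lemma mat_apply_cong: "vcong v w \<Longrightarrow> vcong (mat_apply k v) (mat_apply k w)"
  unfolding vcong_def mat_apply_def by (auto intro!: icong_sum icong_mult)

lemma mat_apply_mat_apply:
  "mat_apply k (mat_apply l v) i =
    (\<Sum>j<\<mu>. (\<Sum>m<\<mu>. mult_matrix k $$ (i, m) * mult_matrix l $$ (m, j)) * v j)"
  unfolding mat_apply_def sum_distrib_left sum_distrib_right mult.assoc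
  by (rule sum.swap)

lemma matrix_products_icong:
  assumes "k < n" "l < n" "i < \<mu>" "j < \<mu>"
  shows "icong scheme_gens (\<Sum>m<\<mu>. mult_matrix k $$ (i, m) * mult_matrix l $$ (m, j))
    (\<Sum>m<\<mu>. mult_matrix l $$ (i, m) * mult_matrix k $$ (m, j))"
proof -
  have *: "icong scheme_gens (\<Sum>m<\<mu>. mult_matrix k $$ (i, m) * mult_matrix l $$ (m, j))
    (\<Sum>m<\<mu>. mult_matrix l $$ (i, m) * mult_matrix k $$ (m, j))" if "k < l" "l < n" for k l
    unfolding icong_def mult_matrix_commutator[OF assms(3,4), symmetric]
    by (rule ring_module.span_base) (use that assms in blast)
  show ?thesis
    using *[of k l] *[of l k] assms icong_sym by (cases k l rule: linorder_cases) auto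
qed

lemma mat_apply_commute:
  assumes "k < n" "l < n"
  shows "vcong (mat_apply k (mat_apply l v)) (mat_apply l (mat_apply k v))"
  unfolding vcong_def
proof (intro allI impI)
  fix i assume i: "i < \<mu>"
  have "icong scheme_gens
      (v j * (\<Sum>m<\<mu>. mult_matrix k $$ (i, m) * mult_matrix l $$ (m, j)))
      (v j * (\<Sum>m<\<mu>. mult_matrix l $$ (i, m) * mult_matrix k $$ (m, j)))" if "j < \<mu>" for j
    by (rule icong_mult, rule matrix_products_icong[OF assms i that])
  then show "icong scheme_gens (mat_apply k (mat_apply l v) i) (mat_apply l (mat_apply k v) i)"
    unfolding mat_apply_mat_apply by (intro icong_sum) (simp add: mult.commute)
qed

lemma mat_apply_pow_cong: "vcong v w \<Longrightarrow> vcong ((mat_apply k ^^ e) v) ((mat_apply k ^^ e) w)"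
  by (induction e) (auto intro: mat_apply_cong)

lemma mat_apply_pow_commute:
  assumes "k < n" "l < n"
  shows "vcong ((mat_apply l ^^ e) (mat_apply k v)) (mat_apply k ((mat_apply l ^^ e) v))"
proof (induction e)
  case (Suc e)
  have "vcong ((mat_apply l ^^ Suc e) (mat_apply k v)) (mat_apply l (mat_apply k ((mat_apply l ^^ e) v)))"
    using mat_apply_cong[OF Suc] by simp
  also have "vcong \<dots> (mat_apply k (mat_apply l ((mat_apply l ^^ e) v)))"
    by (rule mat_apply_commute) (use assms in auto)
  finally show ?case by simp
qed simp

text \<open>Indexing unit vectors by terms makes the vector at the term \<open>1\<close> available without naming its
  index.\<close>

definition unit_at :: "pterm \<Rightarrow> nat \<Rightarrow> 'k::field cpoly" where
  "unit_at u i = (if t i = u then 1 else 0)"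

text \<open>For \<open>m = n\<close> this is \<open>u(A\<^sub>1, \<dots>, A\<^sub>n)\<close> applied to the unit vector at \<open>1\<close>. The
  matrices do not commute in \<open>K[c]\<close>, so an order of the factors has to be fixed.\<close>

primrec term_vec :: "nat \<Rightarrow> pterm \<Rightarrow> nat \<Rightarrow> 'k::field cpoly" where
  "term_vec 0 u = unit_at 0"
| "term_vec (Suc m) u = (mat_apply m ^^ lookup u m) (term_vec m u)"

lemma term_vec_cong: "(\<And>k. k < m \<Longrightarrow> lookup u k = lookup w k) \<Longrightarrow> term_vec m u = term_vec m w"
  by (induction m) auto

lemma term_vec_zero [simp]: "term_vec m 0 = unit_at 0"
  by (induction m) auto

lemma term_vec_mult_var:
  assumes "k < n"
  shows "vcong (term_vec n (single k 1 + u) :: nat \<Rightarrow> 'k::field cpoly) (mat_apply k (term_vec n u))"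
proof -
  have "vcong (term_vec m (single k 1 + u) :: nat \<Rightarrow> 'k cpoly) (mat_apply k (term_vec m u))" if "k < m" "m \<le> n" for m
    using that
  proof (induction m)
    case (Suc m)
    show ?case
    proof (cases "k = m")
      case True
      have "term_vec m (single m 1 + u) = (term_vec m u :: nat \<Rightarrow> 'k cpoly)"
        by (rule term_vec_cong) (simp add: lookup_add lookup_single)
      then show ?thesis by (simp add: True lookup_add)
    next
      case False
      then have "vcong (term_vec m (single k 1 + u) :: nat \<Rightarrow> 'k cpoly) (mat_apply k (term_vec m u))" using Suc by simp
      then have "vcong ((mat_apply m ^^ lookup u m) (term_vec m (single k 1 + u)) :: nat \<Rightarrow> 'k cpoly)
          ((mat_apply m ^^ lookup u m) (mat_apply k (term_vec m u)))"
        by (rule mat_apply_pow_cong)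
      also have "vcong \<dots> (mat_apply k ((mat_apply m ^^ lookup u m) (term_vec m u)))"
        by (rule mat_apply_pow_commute) (use assms Suc.prems in auto)
      finally show ?thesis using False by (simp add: lookup_add lookup_single)
    qed
  qed simp
  then show ?thesis using assms by simp
qed

lemma mat_apply_unit_at:
  assumes "i < \<mu>" "j < \<mu>"
  shows "mat_apply k (unit_at (t j)) i = (mult_matrix k $$ (i, j) :: 'k::field cpoly)"
proof -
  have "mat_apply k (unit_at (t j)) i = (\<Sum>m<\<mu>. if m = j then mult_matrix k $$ (i, m) else (0 :: 'k cpoly))"
    unfolding mat_apply_def by (rule sum.cong) (use assms in \<open>auto simp: unit_at_def t_inj\<close>)
  then show ?thesis using assms by simp
qed

text \<open>Multiplying up from \<open>1\<close> to \<open>u\<close> one indeterminate at a time never leaves \<open>\<O>\<close>, where the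
  matrices take unit vectors to unit vectors in the way multiplication does.\<close>

lemma term_vec_in_O:
  assumes "u \<in> \<O>"
  shows "vcong (term_vec n u) (unit_at u :: nat \<Rightarrow> 'k::field cpoly)"
proof -
  have "u \<in> terms n" using assms O_terms by blast
  then show ?thesis using assms
  proof (induction rule: terms_induct)
    case (step k s)
    have "s \<in> \<O>" using O_dvd_closed[OF step.prems, of s] by (metis term_dvd_def add.commute)
    then obtain j where j: "s = t j" "j < \<mu>" by (auto simp: O_eq)
    have "vcong (term_vec n (single k 1 + s) :: nat \<Rightarrow> 'k cpoly) (mat_apply k (term_vec n s))"
      by (rule term_vec_mult_var[OF step.hyps(1)])
    also have "vcong \<dots> (mat_apply k (unit_at s))"
      by (rule mat_apply_cong) (rule step.IH[OF \<open>s \<in> \<O>\<close>])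
    also have "vcong \<dots> (unit_at (single k 1 + s))"
      unfolding vcong_def j(1)
      using j step.prems by (simp add: unit_at_def mat_apply_unit_at mult_matrix_entry_in)
    finally show ?case .
  qed simp
qed

lemma term_vec_border:
  assumes "m < \<nu>"
  shows "vcong (term_vec n (b m)) (\<lambda>i. cvar (i, m) :: 'k::field cpoly)"
proof -
  obtain k j where kj: "k < n" "j < \<mu>" "b m = single k 1 + t j" using b_border[OF assms] by blast
  have "vcong (term_vec n (b m) :: nat \<Rightarrow> 'k cpoly) (mat_apply k (term_vec n (t j)))"
    unfolding kj(3) by (rule term_vec_mult_var[OF kj(1)])
  also have "vcong \<dots> (mat_apply k (unit_at (t j)))"
    by (rule mat_apply_cong, rule term_vec_in_O, rule t_in_O, rule kj)
  also have "vcong \<dots> (\<lambda>i. cvar (i, m))"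
    unfolding vcong_def using kj(2)
    by (simp add: mat_apply_unit_at mult_matrix_entry_border[OF _ _ assms kj(3)[symmetric]])
  finally show ?thesis .
qed

text \<open>By linearity and the action of the matrices it suffices that each \<open>g\<^sub>j\<close> itself is killed. Its leading
  term goes to the full column \<open>(c\<^sub>i\<^sub>j)\<^sub>i\<close>, while its tail only has the entries with
  \<open>t\<^sub>i\<close> below \<open>b\<^sub>j\<close>; the other entries are among the vanishing indeterminates.\<close>

lemma respects_prebasis_term_vec:
  assumes "i < \<mu>"
  shows "respects_prebasis (terms n) scheme_gens (\<lambda>u. term_vec n u i :: 'k::field cpoly)"
proof -
  have main: "vcong (term_vec n (w + b j) :: nat \<Rightarrow> 'k cpoly) (\<lambda>i. \<Sum>l\<in>tails j. cvar (l, j) * term_vec n (w + t l) i)"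
    if "w \<in> terms n" "j < \<eta>" for w j
    using that(1)
  proof (induction rule: terms_induct)
    case zero
    have j: "j < \<nu>" using that \<eta>_le by simp
    have "icong scheme_gens (term_vec n (b j) i :: 'k cpoly) (\<Sum>l\<in>tails j. cvar (l, j) * term_vec n (t l) i)"
      if i: "i < \<mu>" for i
    proof -
      have "icong scheme_gens (term_vec n (b j) i :: 'k cpoly) (cvar (i, j))"
        by (rule vcongD[OF term_vec_border[OF j] i])
      also have "icong scheme_gens \<dots> (if i \<in> tails j then cvar (i, j) else 0)"
      proof (cases "i \<in> tails j")
        case False
        then have "(i, j) \<in> all_c \<mu> \<nu> - S_set \<sigma> \<mu> t b \<nu>"
          using i j by (auto simp: all_c_def S_set_def tails_def)
        then have "(cvar (i, j) :: 'k cpoly) \<in> ideal_of scheme_gens"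
          by (intro ring_module.span_base) blast
        then show ?thesis using False by (simp add: icong_zero_iff)
      qed simp
      also have "\<dots> = (\<Sum>l\<in>tails j. if l = i then cvar (l, j) else 0)"
        by simp
      also have "\<dots> = (\<Sum>l\<in>tails j. cvar (l, j) * unit_at (t l) i)"
        by (rule sum.cong) (use i in \<open>auto simp: unit_at_def t_inj tailsD(1)\<close>)
      also have "icong scheme_gens \<dots> (\<Sum>l\<in>tails j. cvar (l, j) * term_vec n (t l) i)"
        by (intro icong_sum icong_mult vcongD[OF vcong_sym[OF term_vec_in_O]] t_in_O tailsD(1) i)
      finally show ?thesis .
    qed
    then show ?case by (simp add: vcong_def)
  next
    case (step k w)
    have "vcong (term_vec n (single k 1 + (w + b j)) :: nat \<Rightarrow> 'k cpoly) (mat_apply k (term_vec n (w + b j)))"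
      by (rule term_vec_mult_var[OF step.hyps(1)])
    also have "vcong \<dots> (mat_apply k (\<lambda>i. \<Sum>l\<in>tails j. cvar (l, j) * term_vec n (w + t l) i))"
      by (rule mat_apply_cong[OF step.IH])
    also have "mat_apply k (\<lambda>i. \<Sum>l\<in>tails j. cvar (l, j) * term_vec n (w + t l) i)
        = (\<lambda>i. \<Sum>l\<in>tails j. cvar (l, j) * mat_apply k (term_vec n (w + t l)) i)"
      unfolding mat_apply_def sum_distrib_left
      by (subst sum.swap) (simp only: mult.left_commute)
    also have "vcong \<dots> (\<lambda>i. \<Sum>l\<in>tails j. cvar (l, j) * term_vec n (single k 1 + (w + t l)) i)"
      unfolding vcong_def
      by (intro allI impI icong_sum icong_mult vcongD[OF vcong_sym[OF term_vec_mult_var[OF step.hyps(1)]]])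
    finally show ?case by (simp only: add.assoc)
  qed
  show ?thesis
    unfolding respects_prebasis_def
  proof (intro ballI allI impI)
    fix v j assume v: "v \<in> terms n" and j: "j < \<eta>" "term_dvd (b j) v"
    show "icong scheme_gens (term_vec n v i :: 'k cpoly) (tail_sum (\<lambda>u. term_vec n u i) v j)"
      using vcongD[OF main[OF terms_minus[OF v, of "b j"] j(1)] assms]
      unfolding term_dvd_minus'[OF j(2)] tail_sum_def .
  qed
qed

section \<open>The two ideals agree\<close>

lemma S_corners_subset: "S_corners \<subseteq> all_c \<mu> \<nu>"
  using \<eta>_le by (auto simp: S_set_def all_c_def)

lemma mult_matrix_in_pcarrier:
  assumes "k < n" "i < \<mu>" "j < \<mu>"
  shows "mult_matrix k $$ (i, j) \<in> pcarrier (all_c \<mu> \<nu>)"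
proof (cases "single k 1 + t j \<in> \<O>")
  case True
  then show ?thesis using assms by (simp add: mult_matrix_entry_in)
next
  case False
  then obtain m where m: "m < \<nu>" "single k 1 + t j = b m"
    using border_index assms by blast
  show ?thesis
    unfolding mult_matrix_entry_border[OF assms(2,3) m]
    by (rule pcarrier_cvar) (use assms m in \<open>simp add: all_c_def\<close>)
qed

lemma commutator_gens_carrier: "commutator_gens \<subseteq> pcarrier (all_c \<mu> \<nu>)"
proof clarify
  fix k l i j assume *: "k < l" "l < n" "i < \<mu>" "j < \<mu>"
  show "(mult_matrix k * mult_matrix l - mult_matrix l * mult_matrix k) $$ (i, j) \<in> pcarrier (all_c \<mu> \<nu>)"
    unfolding mult_matrix_commutator[OF *(3,4)]
    using * by (intro pcarrier_diff pcarrier_sum pcarrier_mult mult_matrix_in_pcarrier) auto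
qed

lemma vanishing_gens_carrier: "vanishing_gens \<subseteq> pcarrier (all_c \<mu> \<nu>)"
  by (auto intro: pcarrier_cvar)

lemma groebner_scheme_ideal_eq:
  "groebner_scheme_ideal n \<sigma> \<mu> \<nu> \<eta> t b = ideal_of scheme_gens \<inter> pcarrier S_corners"
  unfolding groebner_scheme_ideal_def L_ideal_def border_scheme_ideal_def
    genideal_poly_ring_sum[OF vanishing_gens_carrier commutator_gens_carrier]
  using pcarrier_mono[OF S_corners_subset] by blast

context
  fixes h :: "nat \<Rightarrow> nat \<Rightarrow> 'k::field xpoly"
  assumes h: "\<And>j k. j < k \<Longrightarrow> k < \<eta> \<Longrightarrow> reduces_completely \<sigma> \<mu> \<eta> t b (S_poly \<sigma> \<mu> t b j k) (h j k)"
begin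

text \<open>Reduction steps multiply coefficients by indeterminates in tails of corners, so they stay in
  \<open>R\<close>.\<close>

lemma reduction_gens_carrier: "reduction_gens h \<subseteq> pcarrier S_corners"
proof clarify
  fix j k i assume jk: "j < k" "k < \<eta>"
  have "(red_step \<sigma> \<mu> \<eta> t b)\<^sup>*\<^sup>* (S_poly \<sigma> \<mu> t b j k) (h j k)"
    using h[OF jk] by (simp add: reduces_completely_def)
  moreover have "coeffs_in S_corners (S_poly \<sigma> \<mu> t b j k :: 'k xpoly)"
    using jk by (intro coeffs_in_S_poly) auto
  ultimately show "lookup (h j k) (t i) \<in> pcarrier S_corners"
    using coeffs_in_reduction unfolding coeffs_in_def by blast
qed

lemma reduction_ideal_eq:
  "reduction_ideal \<sigma> \<mu> \<eta> t b h = ideal_of (reduction_gens h) \<inter> pcarrier S_corners"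
  unfolding reduction_ideal_def by (rule genideal_poly_ring[OF reduction_gens_carrier])

text \<open>The linear extension of \<open>term_vec n\<close> does not change along the reduction. It is \<open>0\<close> on the
  S-polynomial and reads off the coefficients of the reduced form.\<close>

lemma reduction_gens_in_scheme_ideal: "reduction_gens h \<subseteq> ideal_of scheme_gens"
proof clarify
  fix j k i assume jk: "j < k" "k < \<eta>" and i: "i < \<mu>"
  have j: "j < \<eta>" using jk by simp
  define F where "F = (\<lambda>u. term_vec n u i :: 'k cpoly)"
  have resp: "respects_prebasis (terms n) scheme_gens F"
    unfolding F_def by (rule respects_prebasis_term_vec[OF i])
  define L where "L = term_lcm (b j) (b k)"
  have L: "L \<in> terms n"
    unfolding L_def using jk \<eta>_le by (intro term_lcm_terms b_terms) auto
  have dL: "term_dvd (b j) L" "term_dvd (b k) L"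
    unfolding L_def by (rule term_dvd_lcm)+
  have red: "(red_step \<sigma> \<mu> \<eta> t b)\<^sup>*\<^sup>* (S_poly \<sigma> \<mu> t b j k) (h j k)"
    and hk: "keys (h j k) \<subseteq> t ` {..<\<mu>}"
    using h[OF jk] by (simp_all add: reduces_completely_def)
  have "icong scheme_gens (linear_ext F (h j k)) (linear_ext F (S_poly \<sigma> \<mu> t b j k))"
    by (rule icong_sym, rule reduction_icong[OF red keys_S_poly_terms[OF j jk(2)] _ resp])
      (use replaced_term_less less_terms in blast)
  also have "linear_ext F (S_poly \<sigma> \<mu> t b j k) = tail_sum F L k - tail_sum F L j"
    unfolding L_def by (rule linear_ext_S_poly)
  also have "icong scheme_gens \<dots> (F L - F L)"
    by (rule icong_diff; rule icong_sym; rule respects_prebasisD[OF resp L])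
      (use jk dL in auto)
  finally have 1: "icong scheme_gens (linear_ext F (h j k)) 0" by simp
  have "linear_ext F (h j k) = (\<Sum>m<\<mu>. lookup (h j k) (t m) * F (t m))"
    by (rule linear_ext_reduced[OF hk])
  also have "icong scheme_gens \<dots> (\<Sum>m<\<mu>. lookup (h j k) (t m) * unit_at (t m) i)"
    unfolding F_def by (intro icong_sum icong_mult vcongD[OF term_vec_in_O] t_in_O i) simp
  also have "(\<Sum>m<\<mu>. lookup (h j k) (t m) * unit_at (t m) i)
      = (\<Sum>m<\<mu>. if m = i then lookup (h j k) (t m) else 0)"
    by (rule sum.cong) (use i in \<open>auto simp: unit_at_def t_inj\<close>)
  also have "\<dots> = lookup (h j k) (t i)" using i by simp
  finally show "lookup (h j k) (t i) \<in> ideal_of scheme_gens"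
    using icong_trans[OF icong_sym 1] unfolding icong_zero_iff by blast
qed

abbreviation nf_subst :: "'k cpoly \<Rightarrow> 'k cpoly" where
  "nf_subst \<equiv> subst (\<lambda>(i, j). nf i (b j))"

lemma nf_subst_id:
  assumes "p \<in> pcarrier S_corners"
  shows "nf_subst p = p"
  by (rule subst_eq_self[OF assms]) (auto simp: S_set_def nf_corner)

text \<open>Column \<open>j\<close> of the substituted matrix is the normal form of \<open>x\<^sub>k t\<^sub>j\<close>: for \<open>x\<^sub>k t\<^sub>j\<close> in \<open>\<O>\<close> that is a
  unit vector, otherwise a border term is substituted by definition.\<close>

lemma nf_subst_matrix:
  assumes "k < n" "i < \<mu>" "j < \<mu>"
  shows "nf_subst (mult_matrix k $$ (i, j)) = nf i (single k 1 + t j)"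
proof (cases "single k 1 + t j \<in> \<O>")
  case True
  then show ?thesis using assms by (auto simp: mult_matrix_entry_in nf_in_O)
next
  case False
  then obtain m where m: "m < \<nu>" "single k 1 + t j = b m"
    using border_index assms by blast
  show ?thesis
    unfolding mult_matrix_entry_border[OF assms(2,3) m] m(2) by simp
qed

text \<open>Normal forms only involve terms up to the given one, so the indeterminates \<open>c\<^sub>i\<^sub>j\<close> with \<open>b\<^sub>j\<close> below
  \<open>t\<^sub>i\<close> go to \<open>0\<close>. Both products in a commutator compute the normal form of
  \<open>x\<^sub>k x\<^sub>l t\<^sub>j\<close> modulo \<open>J\<close>.\<close>

lemma nf_subst_scheme_gens:
  assumes "p \<in> scheme_gens"
  shows "nf_subst p \<in> ideal_of (reduction_gens h)"
  using assms
proof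
  assume "p \<in> vanishing_gens"
  then obtain i j where p: "p = cvar (i, j)" and ij: "i < \<mu>" "j < \<nu>" "\<not> t i \<prec> b j"
    by (auto simp: all_c_def S_set_def)
  have "(nf i (b j) :: 'k cpoly) = 0"
    using nf_nonzero_le[OF b_terms[OF ij(2)], of i] ij b_notin_O[OF ij(2)] t_in_O[OF ij(1)] by metis
  then show ?thesis by (simp add: p ring_module.span_zero)
next
  let ?G = "reduction_gens h"
  assume "p \<in> commutator_gens"
  then obtain k l i j where p: "p = (mult_matrix k * mult_matrix l - mult_matrix l * mult_matrix k) $$ (i, j)"
    and kl: "k < n" "l < n" and ij: "i < \<mu>" "j < \<mu>" by force
  have prod: "icong ?G (nf_subst (\<Sum>m<\<mu>. mult_matrix k $$ (i, m) * mult_matrix l $$ (m, j)))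
      (nf i (single k 1 + (single l 1 + t j)))" if "k < n" "l < n" for k l
  proof -
    have "nf_subst (\<Sum>m<\<mu>. mult_matrix k $$ (i, m) * mult_matrix l $$ (m, j))
        = (\<Sum>m<\<mu>. nf i (single k 1 + t m) * nf m (single l 1 + t j))"
      unfolding subst_sum subst_mult by (rule sum.cong) (use nf_subst_matrix that ij in auto)
    also have "icong ?G \<dots> (nf i (single k 1 + (single l 1 + t j)))"
      by (rule nf_multiplicative[OF respects_prebasis_nf[OF h]])
        (use that ij t_terms in auto)
    finally show ?thesis .
  qed
  have "single l 1 + (single k 1 + t j) = single k 1 + (single l 1 + t j)"
    by (rule add.left_commute)
  then have "icong ?G (nf_subst p) 0"
    unfolding p mult_matrix_commutator[OF ij] subst_diff
    using icong_diff[OF prod[OF kl] prod[OF kl(2,1)]] by simp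
  then show ?thesis by (simp add: icong_zero_iff)
qed

lemma reduction_ideal_eq_groebner_scheme_ideal:
  "reduction_ideal \<sigma> \<mu> \<eta> t b h = groebner_scheme_ideal n \<sigma> \<mu> \<nu> \<eta> t b"
proof -
  have "p \<in> ideal_of (reduction_gens h)" if "p \<in> ideal_of scheme_gens" "p \<in> pcarrier S_corners" for p
    using subst_ideal_of[OF nf_subst_scheme_gens that(1)] nf_subst_id[OF that(2)] by simp
  moreover have "ideal_of (reduction_gens h) \<subseteq> ideal_of scheme_gens"
    using ring_module.span_mono[OF reduction_gens_in_scheme_ideal] by (simp add: ring_module.span_span)
  ultimately show ?thesis
    unfolding reduction_ideal_eq groebner_scheme_ideal_eq by blast
qed

end

lemma complete_reductions_exist:
  "\<exists>h :: nat \<Rightarrow> nat \<Rightarrow> 'k::field xpoly.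
     \<forall>j k. j < k \<and> k < \<eta> \<longrightarrow> reduces_completely \<sigma> \<mu> \<eta> t b (S_poly \<sigma> \<mu> t b j k) (h j k)"
proof -
  have "\<exists>p :: 'k xpoly. j < k \<and> k < \<eta> \<longrightarrow> reduces_completely \<sigma> \<mu> \<eta> t b (S_poly \<sigma> \<mu> t b j k) p" for j k
  proof (cases "j < k \<and> k < \<eta>")
    case True
    then show ?thesis
      using reduces_completely_exists[OF keys_S_poly_terms[of j k]] by auto
  qed blast
  then show ?thesis by metis
qed

lemma reduction_ideals_eq:
  "(reduction_ideals \<sigma> \<mu> \<eta> t b :: 'k::field cpoly set set) = {groebner_scheme_ideal n \<sigma> \<mu> \<nu> \<eta> t b}"
  unfolding reduction_ideals_def
  using complete_reductions_exist[where 'k = 'k] reduction_ideal_eq_groebner_scheme_ideal[where 'k = 'k]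
  by auto

end

theorem mainTheorem4:
  fixes n \<mu> \<nu> \<eta> :: nat
    and \<O> :: "pterm set"
    and \<sigma> :: "pterm rel"
    and t b :: "nat \<Rightarrow> pterm"
  assumes "order_ideal n \<O>" and "\<O> \<noteq> {}"
    and "term_ordering n \<sigma>"
    and "bij_betw t {..<\<mu>} \<O>"
    and "bij_betw b {..<\<nu>} (border n \<O>)"
    and "\<eta> \<le> \<nu>" and "b ` {..<\<eta>} = corners n \<O>"
  shows "(reduction_ideals \<sigma> \<mu> \<eta> t b :: 'k::field cpoly set set)
           = {groebner_scheme_ideal n \<sigma> \<mu> \<nu> \<eta> t b}"
proof -
  interpret prebasis_setup n \<sigma> \<mu> \<nu> \<eta> \<O> t b
    by unfold_locales (rule assms)+
  show ?thesis by (rule reduction_ideals_eq)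
qed

end
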